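(* Let $n\ge2$ and let $K\subset\mathbb{R}^n$ be a $C^3$-smooth convex body with nowhere vanishing curvature. Let $H$ be a hyperplane passing through the center of mass of $K$, and for $t>0$ let $K(t)$ be the image of $K$ under the orthogonal affinity of ratio $t$ with $H$ as its fixed hyperplane. Let $U_K(t)$ denote the number of unstable points of $K(t)$ with respect to its center of mass. If $t$ is sufficiently large, then $U_K(t)=2$.
   Context: The orthogonal affinity of ratio $t$ with fixed hyperplane $H$ fixes $H$ pointwise and multiplies the signed distance from $H$ by $t$ in the direction orthogonal to $H$ (so the center of mass of $K(t)$ is that of $K$). An unstable (equilibrium) point of a smooth convex body with respect to its center of mass $o$ is a boundary point at which the Euclidean distance from $o$, restricted to the boundary of the body, has a local maximum. Nowhere vanishing curvature means that the Gaussian curvature of the boundary is nonzero at every point (so $K$ is strictly convex). *)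

theory Defs
  imports "HOL-Analysis.Analysis"
begin

text \<open>\<open>Ck_on k U f\<close>: the function \<open>f\<close> is of class $C^k$ on the open set \<open>U\<close>
  (all iterated directional derivatives up to order \<open>k\<close> exist and are continuous).\<close>

primrec Ck_on :: "nat \<Rightarrow> 'a::euclidean_space set \<Rightarrow> ('a \<Rightarrow> real) \<Rightarrow> bool" where
  "Ck_on 0 U f \<longleftrightarrow> continuous_on U f"
| "Ck_on (Suc k) U f \<longleftrightarrow>
     (\<forall>x\<in>U. f differentiable (at x)) \<and>
     (\<forall>v. Ck_on k U (\<lambda>x. frechet_derivative f (at x) v))"

definition Ck_hypersurface :: "nat \<Rightarrow> 'a::euclidean_space set \<Rightarrow> bool" where
  "Ck_hypersurface k S \<longleftrightarrow>
     (\<forall>p\<in>S. \<exists>U f. open U \<and> p \<in> U \<and> Ck_on k U f \<and>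
        S \<inter> U = {x \<in> U. f x = 0} \<and>
        (\<forall>x\<in>S \<inter> U. frechet_derivative f (at x) \<noteq> (\<lambda>v. 0)))"

definition convex_body :: "'a::euclidean_space set \<Rightarrow> bool" where
  "convex_body K \<longleftrightarrow> convex K \<and> compact K \<and> interior K \<noteq> {}"

definition Ck_convex_body :: "nat \<Rightarrow> 'a::euclidean_space set \<Rightarrow> bool" where
  "Ck_convex_body k K \<longleftrightarrow> convex_body K \<and> Ck_hypersurface k (frontier K)"

text \<open>Outer unit normal. It is unique at every boundary point of a convex body whose
  boundary is a $C^1$ hypersurface; no meaning is attached to it elsewhere.\<close>

definition gauss_map :: "'a::euclidean_space set \<Rightarrow> 'a \<Rightarrow> 'a" where
  "gauss_map K x = (THE u. norm u = 1 \<and> (\<forall>y\<in>K. u \<bullet> y \<le> u \<bullet> x))"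

text \<open>The Gaussian curvature at \<open>x\<close> is the determinant of the shape operator, i.e. of the
  differential of the Gauss map as an endomorphism of the tangent space, which is the
  orthogonal complement of the unit normal \<open>u\<close>. To use the determinant of the ambient
  space, the shape operator is extended by the identity on the line spanned by \<open>u\<close>, which
  does not change its determinant. The derivative within the boundary is only determined
  on tangent vectors, and \<open>v - (v \<bullet> u) *\<^sub>R u\<close> is tangent.\<close>

definition gaussian_curvature :: "(real ^ 'n) set \<Rightarrow> real ^ 'n \<Rightarrow> real" where
  "gaussian_curvature K x =
     (let u = gauss_map K x;
          D = frechet_derivative (gauss_map K) (at x within frontier K)
      in det (matrix (\<lambda>v. D (v - (v \<bullet> u) *\<^sub>R u) + (v \<bullet> u) *\<^sub>R u)))"

definition center_of_mass :: "'a::euclidean_space set \<Rightarrow> 'a" where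
  "center_of_mass K = (1 / measure lebesgue K) *\<^sub>R integral K (\<lambda>x. x)"

definition hyperplane :: "'a::euclidean_space set \<Rightarrow> bool" where
  "hyperplane H \<longleftrightarrow> (\<exists>a b. a \<noteq> 0 \<and> H = {x. a \<bullet> x = b})"

text \<open>For a hyperplane \<open>H\<close>, \<open>closest_point H x\<close> is the orthogonal projection of \<open>x\<close> to \<open>H\<close>.\<close>

definition orth_affinity :: "'a::euclidean_space set \<Rightarrow> real \<Rightarrow> 'a \<Rightarrow> 'a" where
  "orth_affinity H t x = closest_point H x + t *\<^sub>R (x - closest_point H x)"

definition unstable_points :: "'a::euclidean_space set \<Rightarrow> 'a set" where
  "unstable_points K =
     {p \<in> frontier K. \<exists>e>0. \<forall>q\<in>frontier K \<inter> ball p e.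
        dist (center_of_mass K) q \<le> dist (center_of_mass K) p}"

definition num_unstable :: "'a::euclidean_space set \<Rightarrow> 'a set \<Rightarrow> real \<Rightarrow> nat" where
  "num_unstable K H t = card (unstable_points (orth_affinity H t ` K))"

end

theory Submission imports Defs begin

text \<open>
  Let \<open>c\<close> be the center of mass of \<open>K\<close>, \<open>u\<close> a unit normal of \<open>H\<close>, and \<open>h x = u \<bullet> (x - c)\<close> the
  height over \<open>H\<close>. The affinity fixes \<open>c\<close> and multiplies \<open>h\<close> by \<open>t\<close>, so pulling the squared
  distance from \<open>c\<close> back to \<open>K\<close> gives \<open>(t\<^sup>2 - 1) * (h\<^sup>2 + e * norm (x - c)\<^sup>2)\<close> with
  \<open>e = 1 / (t\<^sup>2 - 1)\<close>. The unstable points of \<open>K(t)\<close> therefore correspond to the local maxima on the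
  boundary of \<open>K\<close> of \<open>Q = h\<^sup>2 + e * norm (x - c)\<^sup>2\<close>, a small perturbation of \<open>h\<^sup>2\<close> when \<open>t\<close> is large,
  and it has to be seen that there are exactly two of them for small \<open>e > 0\<close>.

  Let \<open>N\<close> and \<open>S\<close> be the poles: the highest and the lowest point of \<open>K\<close>. They are unique because the
  curvature does not vanish there (\<open>pole_unique\<close>). Since \<open>Q\<close> increases along rays from the
  interior point \<open>c\<close>, a local maximum \<open>p\<close> on the boundary is one on the whole of \<open>K\<close>
  (\<open>local_max_on_body\<close>). By convexity half the gradient, \<open>g = h p *\<^sub>R u + e *\<^sub>R (p - c)\<close>, then
  is an outer normal of \<open>K\<close> at \<open>p\<close>. What this implies depends on the place:

  \<^item> Near a boundary point with \<open>h \<noteq> 0\<close> other than a pole, \<open>g\<close> is almost a multiple of \<open>u\<close>, which is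
    not normal to \<open>K\<close> there; there is no local maximum (\<open>no_local_max_near_regular_point\<close>).

  \<^item> Near the equator \<open>h = 0\<close> the gradient is tiny, so the first-order condition allows any normal
    direction. But \<open>Q\<close> is strictly convex in the direction \<open>u\<close>, which is far from being normal to
    \<open>K\<close>, and \<open>K\<close> contains a ball of fixed radius touching its boundary at \<open>p\<close>; moving along that ball in the
    tangent direction closest to \<open>u\<close> increases \<open>Q\<close> to second order (\<open>no_local_max_near_equator\<close>).

  \<^item> Near a pole the nonvanishing curvature makes the outer normals strongly monotone. Two
    local maxima there would have normals proportional to their gradients, whose difference
    is of order \<open>e\<close> along the chord joining them, too little for strong monotonicity
    (\<open>local_max_unique_near_pole\<close>).

  By compactness finitely many such neighbourhoods cover the boundary, so at most two local maxima
  exist for small \<open>e\<close>. Conversely the maximum of \<open>Q\<close> over the upper half of the boundary is a local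
  maximum with \<open>h > 0\<close>, because on the equator \<open>Q\<close> is only of order \<open>e\<close>; likewise
  below (\<open>local_max_exists_above\<close>).

  Smoothness and curvature enter through a local defining function. Its second derivative,
  restricted to the tangent space, is up to scaling the shape operator: positive semidefinite by
  convexity and nondegenerate by the curvature hypothesis, hence, being symmetric, positive definite
  (\<open>F'_positive_definite\<close>).
\<close>

section \<open>Regular level sets\<close>

lemma norm_scaleR_add_power2:
  fixes h k :: "'a::real_inner"
  shows "(norm (a *\<^sub>R h + b *\<^sub>R k))\<^sup>2 = a\<^sup>2 * (norm h)\<^sup>2 + 2 * (a * b) * (k \<bullet> h) + b\<^sup>2 * (norm k)\<^sup>2"
  unfolding power2_norm_eq_inner
  by (simp add: inner_add_left inner_add_right inner_commute[of h k] power2_eq_square algebra_simps)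

lemma segment_mean_value:
  fixes g :: "'a::real_normed_vector \<Rightarrow> real"
  assumes "\<And>x. x \<in> closed_segment a b \<Longrightarrow> (g has_derivative g' x) (at x)"
  obtains z where "z \<in> closed_segment a b" "g b - g a = g' z (b - a)"
proof -
  let ?c = "\<lambda>s. a + s *\<^sub>R (b - a)"
  have seg: "?c s \<in> closed_segment a b" if "s \<in> {0..1}" for s :: real
    using that by (auto simp: in_segment algebra_simps intro!: exI[of _ s])
  have "\<exists>s\<in>{0..1}. g (?c 1) - g (?c 0) = g' (?c s) ((1 - 0) *\<^sub>R (b - a))"
  proof (rule mvt_very_simple)
    fix s :: real assume s: "0 \<le> s" "s \<le> 1"
    have "(?c has_derivative (\<lambda>h. h *\<^sub>R (b - a))) (at s within {0..1})"
      by (auto intro!: derivative_eq_intros)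
    from has_derivative_compose[OF this assms[OF seg]] s
    show "((\<lambda>s. g (?c s)) has_derivative (\<lambda>h. g' (?c s) (h *\<^sub>R (b - a)))) (at s within {0..1})"
      by auto
  qed simp
  then obtain s where s: "s \<in> {0..1}" "g b - g a = g' (?c s) (b - a)" by auto
  then show ?thesis using that[OF seg[OF s(1)]] by blast
qed

lemma tangent_sequence_tendsto:
  fixes p :: "'a::real_normed_vector"
  assumes s: "\<And>k::nat. s k > 0" "s \<longlonglongrightarrow> 0"
    and v: "(\<lambda>k. (1 / s k) *\<^sub>R (y k - p)) \<longlonglongrightarrow> v"
  shows "y \<longlonglongrightarrow> p"
proof -
  have "(\<lambda>k. s k *\<^sub>R ((1 / s k) *\<^sub>R (y k - p))) \<longlonglongrightarrow> 0 *\<^sub>R v"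
    by (intro tendsto_scaleR s v)
  moreover have "s k *\<^sub>R ((1 / s k) *\<^sub>R (y k - p)) = y k - p" for k
    using s(1)[of k] by simp
  ultimately show ?thesis by (simp add: LIM_zero_iff)
qed

text \<open>A derivative within a set is determined only on tangent vectors of the set. Vectors are
  recognized as tangent here by sequences in \<open>S\<close> whose difference quotients at \<open>p\<close> converge to them.\<close>

lemma has_derivative_along_tangent_sequence:
  fixes g :: "'a::real_normed_vector \<Rightarrow> 'b::real_normed_vector"
  assumes g: "(g has_derivative g') (at p within S)"
    and S: "\<And>k. y k \<in> S" and s: "\<And>k::nat. s k > 0" "s \<longlonglongrightarrow> 0"
    and v: "(\<lambda>k. (1 / s k) *\<^sub>R (y k - p)) \<longlonglongrightarrow> v"
  shows "(\<lambda>k. (1 / s k) *\<^sub>R (g (y k) - g p)) \<longlonglongrightarrow> g' v"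
proof -
  interpret g': bounded_linear g' using g by (rule has_derivative_bounded_linear)
  let ?w = "\<lambda>k. (1 / s k) *\<^sub>R (y k - p)"
  let ?R = "\<lambda>k. (1 / s k) *\<^sub>R (g (y k) - g p - g' (y k - p))"
  have yp: "(\<lambda>k. y k - p) \<longlonglongrightarrow> 0"
    using tangent_sequence_tendsto[OF s v] by (simp add: LIM_zero_iff)
  obtain B where B: "B > 0" "\<And>k. norm (?w k) \<le> B"
    using convergent_imp_Bseq[OF convergentI[OF v]] by (auto simp: Bseq_def)
  have R0: "?R \<longlonglongrightarrow> 0"
  proof (rule tendstoI)
    fix e :: real assume e: "e > 0"
    then have "e / (2 * B) > 0" using B by simp
    then obtain d where d: "d > 0"
      "\<And>z. z \<in> S \<Longrightarrow> norm (z - p) < d \<Longrightarrow> norm (g z - g p - g' (z - p)) \<le> e / (2 * B) * norm (z - p)"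
      using g unfolding has_derivative_within_alt by blast
    have "\<forall>\<^sub>F k in sequentially. norm (y k - p) < d"
      using tendstoD[OF yp d(1)] by (simp add: dist_norm)
    then show "\<forall>\<^sub>F k in sequentially. dist (?R k) 0 < e"
    proof eventually_elim
      case (elim k)
      have "norm (?R k) = (1 / s k) * norm (g (y k) - g p - g' (y k - p))"
        using s(1)[of k] by simp
      also have "\<dots> \<le> (1 / s k) * (e / (2 * B) * norm (y k - p))"
        using d(2)[OF S elim] s(1)[of k] by (intro mult_left_mono) auto
      also have "\<dots> = e / (2 * B) * norm (?w k)"
        using s(1)[of k] by simp
      also have "\<dots> \<le> e / (2 * B) * B"
        using B e by (intro mult_left_mono) auto
      also have "\<dots> < e" using B e by simp
      finally show ?case by simp
    qed
  qed
  have "(\<lambda>k. ?R k + g' (?w k)) \<longlonglongrightarrow> 0 + g' v"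
    by (intro tendsto_add R0 g'.tendsto v)
  moreover have "?R k + g' (?w k) = (1 / s k) *\<^sub>R (g (y k) - g p)" for k
    by (simp add: g'.scaleR flip: scaleR_add_right)
  ultimately show ?thesis by simp
qed

text \<open>A defining function \<open>f\<close> of the hypersurface \<open>S\<close> in \<open>U\<close>, with gradient \<open>F\<close> and Hessian \<open>F'\<close>.\<close>

locale C2_chart =
  fixes S U :: "'a::euclidean_space set" and f :: "'a \<Rightarrow> real"
    and F :: "'a \<Rightarrow> 'a" and F' :: "'a \<Rightarrow> 'a \<Rightarrow> 'a"
  assumes open_U: "open U"
    and f_deriv: "\<And>x. x \<in> U \<Longrightarrow> (f has_derivative (\<lambda>v. F x \<bullet> v)) (at x)"
    and F_deriv: "\<And>x. x \<in> U \<Longrightarrow> (F has_derivative F' x) (at x)"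
    and F'_cont: "\<And>v. continuous_on U (\<lambda>x. F' x v)"
    and S_eq: "S \<inter> U = {x \<in> U. f x = 0}"
    and F_nonzero: "\<And>x. x \<in> S \<Longrightarrow> x \<in> U \<Longrightarrow> F x \<noteq> 0"
begin

lemma in_S_iff: "x \<in> U \<Longrightarrow> x \<in> S \<longleftrightarrow> f x = 0"
  using S_eq by blast

lemma F_continuous: "continuous_on U F"
  by (meson F_deriv continuous_at_imp_continuous_on has_derivative_continuous)

lemma f_continuous: "continuous_on U f"
  by (meson f_deriv continuous_at_imp_continuous_on has_derivative_continuous)

lemma linear_F': "x \<in> U \<Longrightarrow> linear (F' x)"
  using F_deriv has_derivative_linear by blast

lemma f_mean_value:
  assumes "closed_segment a b \<subseteq> U"
  obtains z where "z \<in> closed_segment a b" "f b - f a = F z \<bullet> (b - a)"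
  using segment_mean_value[of a b f "\<lambda>x v. F x \<bullet> v"] f_deriv assms by blast

lemma F_mean_value:
  assumes "closed_segment a b \<subseteq> U"
  obtains z where "z \<in> closed_segment a b" "(F b - F a) \<bullet> w = F' z (b - a) \<bullet> w"
proof (rule segment_mean_value[of a b "\<lambda>x. F x \<bullet> w" "\<lambda>x v. F' x v \<bullet> w"])
  show "((\<lambda>x. F x \<bullet> w) has_derivative (\<lambda>v. F' x v \<bullet> w)) (at x)" if "x \<in> closed_segment a b" for x
    using that assms by (intro has_derivative_inner_left F_deriv) auto
qed (use that in \<open>simp add: inner_diff_left\<close>)

text \<open>Continuity of the Hessian is assumed in each fixed direction only; in finite dimension it
  is automatically joint in point and direction.\<close>

lemma F'_tendsto:
  assumes p: "p \<in> U" and z: "z \<longlonglongrightarrow> p" and v: "v \<longlonglongrightarrow> w"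
  shows "(\<lambda>k. F' (z k) (v k)) \<longlonglongrightarrow> F' p w"
proof -
  have expand: "F' x h = (\<Sum>b\<in>Basis. (h \<bullet> b) *\<^sub>R F' x b)" if "x \<in> U" for x h
    using linear_F'[OF that]
    by (subst (1) euclidean_representation[of h, symmetric])
       (simp add: linear_sum linear_cmul)
  have "(\<lambda>k. \<Sum>b\<in>Basis. (v k \<bullet> b) *\<^sub>R F' (z k) b) \<longlonglongrightarrow> (\<Sum>b\<in>Basis. (w \<bullet> b) *\<^sub>R F' p b)"
  proof (intro tendsto_sum tendsto_scaleR tendsto_inner tendsto_const v)
    fix b :: 'a
    have "isCont (\<lambda>x. F' x b) p"
      using F'_cont open_U p by (simp add: continuous_on_eq_continuous_at)
    then show "(\<lambda>k. F' (z k) b) \<longlonglongrightarrow> F' p b"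
      using z by (rule isCont_tendsto_compose)
  qed
  then have "(\<lambda>k. \<Sum>b\<in>Basis. (v k \<bullet> b) *\<^sub>R F' (z k) b) \<longlonglongrightarrow> F' p w"
    by (subst expand[OF p])
  moreover have "\<forall>\<^sub>F k in sequentially. z k \<in> U"
    using topological_tendstoD[OF z open_U p] .
  then have "\<forall>\<^sub>F k in sequentially. (\<Sum>b\<in>Basis. (v k \<bullet> b) *\<^sub>R F' (z k) b) = F' (z k) (v k)"
    by eventually_elim (rule expand[symmetric])
  ultimately show ?thesis by (rule Lim_transform_eventually)
qed

text \<open>The mixed second difference is a Hessian entry at a nearby point: the mean value theorem is applied
  to \<open>y \<mapsto> f (y + s w) - f y\<close> and then to the gradient. As the difference is symmetric in
  \<open>v\<close> and \<open>w\<close>, the symmetry of the Hessian follows in the limit.\<close>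

lemma second_difference:
  assumes x: "ball x r \<subseteq> U" and s: "s > 0" "s * (norm v + norm w) < r"
  obtains z where "norm (z - x) \<le> s * (norm v + norm w)"
    "f (x + s *\<^sub>R v + s *\<^sub>R w) - f (x + s *\<^sub>R v) - f (x + s *\<^sub>R w) + f x = s\<^sup>2 * (F' z w \<bullet> v)"
proof -
  have in_U: "y \<in> U" if "norm (y - x) \<le> s * (norm v + norm w)" for y
    using that s x by (auto simp: subset_iff dist_norm norm_minus_commute)
  have seg: "norm (y - x) \<le> s * norm v" if "y \<in> closed_segment x (x + s *\<^sub>R v)" for y
    using segment_bound1[OF that] s by simp
  have bnd: "norm (y - x) \<le> s * (norm v + norm w)" if "norm (y - x) \<le> s * norm v" for y
    using that s by (smt (verit) distrib_left mult_nonneg_nonneg norm_ge_zero)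
  have bnd': "norm (y + h - x) \<le> s * (norm v + norm w)"
    if "norm (y - x) \<le> s * norm v" "norm h \<le> s * norm w" for y h
    using that norm_triangle_ineq[of "y - x" h] by (simp add: algebra_simps)
  have deriv: "((\<lambda>y. f (y + s *\<^sub>R w) - f y) has_derivative (\<lambda>h. (F (y + s *\<^sub>R w) - F y) \<bullet> h)) (at y)"
    if "y \<in> closed_segment x (x + s *\<^sub>R v)" for y
  proof -
    have "((\<lambda>y. f (y + s *\<^sub>R w)) has_derivative (\<lambda>h. F (y + s *\<^sub>R w) \<bullet> h)) (at y)"
    proof (rule has_derivative_compose[of "\<lambda>y. y + s *\<^sub>R w" "\<lambda>h. h" y UNIV f])
      show "((\<lambda>y. y + s *\<^sub>R w) has_derivative (\<lambda>h. h)) (at y)"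
        by (auto intro!: derivative_eq_intros)
      show "(f has_derivative (\<lambda>h. F (y + s *\<^sub>R w) \<bullet> h)) (at (y + s *\<^sub>R w))"
        using bnd'[OF seg[OF that], of "s *\<^sub>R w"] s by (intro f_deriv in_U) simp
    qed
    moreover have "(f has_derivative (\<lambda>h. F y \<bullet> h)) (at y)"
      using in_U bnd seg[OF that] by (intro f_deriv) auto
    ultimately show ?thesis
      by (auto intro!: derivative_eq_intros simp: inner_diff_left)
  qed
  obtain y where y: "y \<in> closed_segment x (x + s *\<^sub>R v)"
    "f (x + s *\<^sub>R v + s *\<^sub>R w) - f (x + s *\<^sub>R v) - (f (x + s *\<^sub>R w) - f x)
      = (F (y + s *\<^sub>R w) - F y) \<bullet> (s *\<^sub>R v)"
    using segment_mean_value[OF deriv] by (metis add_diff_cancel_left')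
  have segw: "norm (z - x) \<le> s * (norm v + norm w)" if "z \<in> closed_segment y (y + s *\<^sub>R w)" for z
    using bnd'[OF seg[OF y(1)], of "z - y"] segment_bound1[OF that] s by simp
  obtain z where z: "z \<in> closed_segment y (y + s *\<^sub>R w)"
    "(F (y + s *\<^sub>R w) - F y) \<bullet> v = F' z (y + s *\<^sub>R w - y) \<bullet> v"
    using F_mean_value[of y "y + s *\<^sub>R w" v] segw in_U by blast
  have "F' z (s *\<^sub>R w) = s *\<^sub>R F' z w"
    using linear_F'[OF in_U[OF segw[OF z(1)]]] by (simp add: linear_cmul)
  then show ?thesis
    using that[OF segw[OF z(1)]] y(2) z(2) by (simp add: power2_eq_square)
qed

lemma F'_symmetric:
  assumes x: "x \<in> U"
  shows "F' x v \<bullet> w = F' x w \<bullet> v"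
proof -
  obtain r where r: "r > 0" "ball x r \<subseteq> U" using open_U x by (meson open_contains_ball)
  define N where "N = norm v + norm w + 1"
  have N: "N > 0" "norm v + norm w < N" "norm w + norm v < N"
    using norm_ge_zero[of v] norm_ge_zero[of w] unfolding N_def by linarith+
  define s where "s k = r / (N * real (Suc k))" for k
  have s: "s k > 0" for k using r N by (simp add: s_def)
  have sr: "s k * (norm v + norm w) < r" for k
  proof -
    have "s k * (norm v + norm w) < s k * N" using s N by simp
    also have "\<dots> = r / real (Suc k)" using N by (simp add: s_def)
    also have "\<dots> \<le> r / 1" using r by (intro divide_left_mono) auto
    also have "\<dots> = r" by simp
    finally show ?thesis .
  qed
  have s0: "s \<longlonglongrightarrow> 0"
    using tendsto_mult_right_zero[OF LIMSEQ_inverse_real_of_nat, of "r / N"]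
    by (simp add: s_def[abs_def] field_simps)
  have "\<exists>z z'. norm (z - x) \<le> s k * (norm v + norm w) \<and> norm (z' - x) \<le> s k * (norm v + norm w) \<and>
      F' z w \<bullet> v = F' z' v \<bullet> w" for k
  proof -
    obtain z where z: "norm (z - x) \<le> s k * (norm v + norm w)"
      "f (x + s k *\<^sub>R v + s k *\<^sub>R w) - f (x + s k *\<^sub>R v) - f (x + s k *\<^sub>R w) + f x = (s k)\<^sup>2 * (F' z w \<bullet> v)"
      using second_difference[OF r(2) s sr] by metis
    obtain z' where z': "norm (z' - x) \<le> s k * (norm w + norm v)"
      "f (x + s k *\<^sub>R w + s k *\<^sub>R v) - f (x + s k *\<^sub>R w) - f (x + s k *\<^sub>R v) + f x = (s k)\<^sup>2 * (F' z' v \<bullet> w)"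
      using second_difference[OF r(2) s, of k w v] sr[of k] by (metis add.commute)
    have "(s k)\<^sup>2 * (F' z w \<bullet> v) = (s k)\<^sup>2 * (F' z' v \<bullet> w)"
    proof -
      have "f (x + s k *\<^sub>R w + s k *\<^sub>R v) = f (x + s k *\<^sub>R v + s k *\<^sub>R w)" by (simp add: add_ac)
      then show ?thesis using z(2) z'(2) by linarith
    qed
    then have "F' z w \<bullet> v = F' z' v \<bullet> w" using s[of k] by simp
    then show ?thesis using z(1) z'(1) by (auto simp: add.commute)
  qed
  then obtain z z' where z: "\<And>k. norm (z k - x) \<le> s k * (norm v + norm w)"
    "\<And>k. norm (z' k - x) \<le> s k * (norm v + norm w)" "\<And>k. F' (z k) w \<bullet> v = F' (z' k) v \<bullet> w"
    by metis
  have lim: "y \<longlonglongrightarrow> x" if "\<And>k. norm (y k - x) \<le> s k * (norm v + norm w)" for y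
  proof -
    have "(\<lambda>k. s k * (norm v + norm w)) \<longlonglongrightarrow> 0"
      using tendsto_mult_left_zero[OF s0] .
    then have "(\<lambda>k. y k - x) \<longlonglongrightarrow> 0"
      by (rule Lim_null_comparison[rotated]) (simp add: that)
    then show ?thesis by (simp add: LIM_zero_iff)
  qed
  have "(\<lambda>k. F' (z k) w \<bullet> v) \<longlonglongrightarrow> F' x w \<bullet> v" "(\<lambda>k. F' (z' k) v \<bullet> w) \<longlonglongrightarrow> F' x v \<bullet> w"
    by (intro tendsto_inner tendsto_const F'_tendsto x lim z)+
  then show ?thesis using z(3) LIMSEQ_unique by auto
qed

text \<open>Every vector orthogonal to the gradient is tangent. On the line through \<open>p + s v\<close> in the direction of
  the gradient, \<open>f\<close> changes sign within distance \<open>s \<eta>\<close> once \<open>s\<close> is small, so the intermediate value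
  theorem puts a point of \<open>S\<close> there.\<close>

lemma tangent_sequence:
  assumes p: "p \<in> S" "p \<in> U" and v: "F p \<bullet> v = 0"
  obtains y and s :: "nat \<Rightarrow> real" where "\<And>k. y k \<in> S" "\<And>k. s k > 0" "s \<longlonglongrightarrow> 0"
    "(\<lambda>k. (1 / s k) *\<^sub>R (y k - p)) \<longlonglongrightarrow> v"
proof -
  have fp: "f p = 0" using p in_S_iff by blast
  have FF: "F p \<bullet> F p > 0" using F_nonzero[OF p] by simp
  have dir: "((\<lambda>s. f (p + s *\<^sub>R d)) has_real_derivative (F p \<bullet> d)) (at 0)" for d
  proof -
    have "((\<lambda>s::real. p + s *\<^sub>R d) has_derivative (\<lambda>h. h *\<^sub>R d)) (at 0)"
      by (auto intro!: derivative_eq_intros)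
    moreover have "(f has_derivative (\<lambda>v. F p \<bullet> v)) (at (p + 0 *\<^sub>R d))"
      using f_deriv[OF p(2)] by simp
    ultimately have "((\<lambda>s. f (p + s *\<^sub>R d)) has_derivative (\<lambda>h. F p \<bullet> (h *\<^sub>R d))) (at 0)"
      by (rule has_derivative_compose)
    moreover have "(\<lambda>h. F p \<bullet> (h *\<^sub>R d)) = (*) (F p \<bullet> d)"
      by (auto simp: fun_eq_iff)
    ultimately show ?thesis
      unfolding has_field_derivative_def by simp
  qed
  have "\<exists>s \<kappa>. 0 < s \<and> s < \<eta> \<and> \<bar>\<kappa>\<bar> \<le> \<eta> \<and> p + s *\<^sub>R (v + \<kappa> *\<^sub>R F p) \<in> S" if \<eta>: "\<eta> > 0" for \<eta> :: real
  proof -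
    obtain r where r: "r > 0" "ball p r \<subseteq> U" using open_U p by (meson open_contains_ball)
    obtain d1 where d1: "d1 > 0" "\<And>h. 0 < h \<Longrightarrow> h < d1 \<Longrightarrow> 0 < f (p + h *\<^sub>R (v + \<eta> *\<^sub>R F p))"
      using DERIV_pos_inc_right[OF dir[of "v + \<eta> *\<^sub>R F p"]] FF \<eta> v fp by (auto simp: inner_add_right)
    obtain d2 where d2: "d2 > 0" "\<And>h. 0 < h \<Longrightarrow> h < d2 \<Longrightarrow> f (p + h *\<^sub>R (v + (- \<eta>) *\<^sub>R F p)) < 0"
      using DERIV_neg_dec_right[OF dir[of "v + (- \<eta>) *\<^sub>R F p"]] FF \<eta> v fp by (auto simp: inner_diff_right)
    define N where "N = norm v + \<eta> * norm (F p) + 1"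
    have N: "N > 0" using \<eta> by (simp add: N_def add_nonneg_pos)
    define s where "s = min (min d1 d2) (min \<eta> (r / N)) / 2"
    have s: "0 < s" "s < d1" "s < d2" "s < \<eta>" "s < r / N"
    proof -
      have "r / N > 0" using r N by simp
      moreover from this have "0 < s" using d1(1) d2(1) \<eta> by (simp add: s_def)
      moreover have "2 * s \<le> d1" "2 * s \<le> d2" "2 * s \<le> \<eta>" "2 * s \<le> r / N"
        unfolding s_def by simp_all
      ultimately show "0 < s" "s < d1" "s < d2" "s < \<eta>" "s < r / N"
        by linarith+
    qed
    let ?c = "\<lambda>\<kappa>. p + s *\<^sub>R (v + \<kappa> *\<^sub>R F p)"
    have inU: "?c \<kappa> \<in> U" if "\<bar>\<kappa>\<bar> \<le> \<eta>" for \<kappa>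
    proof -
      have "norm (v + \<kappa> *\<^sub>R F p) \<le> norm v + \<bar>\<kappa>\<bar> * norm (F p)"
        using norm_triangle_ineq[of v "\<kappa> *\<^sub>R F p"] by simp
      also have "\<dots> \<le> N" using that mult_right_mono[OF that, of "norm (F p)"] by (simp add: N_def)
      finally have "s * norm (v + \<kappa> *\<^sub>R F p) \<le> s * N" using s by simp
      also have "\<dots> < r" using s N by (simp add: field_simps)
      finally show ?thesis using r s by (auto simp: subset_iff dist_norm)
    qed
    have "\<exists>\<kappa>. - \<eta> \<le> \<kappa> \<and> \<kappa> \<le> \<eta> \<and> f (?c \<kappa>) = 0"
    proof (rule IVT')
      show "f (?c (- \<eta>)) \<le> 0" "0 \<le> f (?c \<eta>)" using d1(2)[of s] d2(2)[of s] s by auto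
      show "continuous_on {- \<eta>..\<eta>} (\<lambda>\<kappa>. f (?c \<kappa>))"
        using inU by (intro continuous_on_compose2[OF f_continuous] continuous_intros) auto
    qed (use \<eta> in simp)
    then obtain \<kappa> where \<kappa>: "- \<eta> \<le> \<kappa>" "\<kappa> \<le> \<eta>" "f (?c \<kappa>) = 0" by blast
    then have "\<bar>\<kappa>\<bar> \<le> \<eta>" by linarith
    then have "?c \<kappa> \<in> S" using inU in_S_iff \<kappa>(3) by blast
    then show ?thesis using s \<open>\<bar>\<kappa>\<bar> \<le> \<eta>\<close> by blast
  qed
  then have "\<exists>s \<kappa>. 0 < s \<and> s < inverse (real (Suc k)) \<and> \<bar>\<kappa>\<bar> \<le> inverse (real (Suc k)) \<and>
      p + s *\<^sub>R (v + \<kappa> *\<^sub>R F p) \<in> S" for k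
    by (metis inverse_positive_iff_positive of_nat_0_less_iff zero_less_Suc)
  then obtain s \<kappa> where *: "\<And>k. 0 < s k" "\<And>k. s k < inverse (real (Suc k))"
    "\<And>k. \<bar>\<kappa> k\<bar> \<le> inverse (real (Suc k))" "\<And>k. p + s k *\<^sub>R (v + \<kappa> k *\<^sub>R F p) \<in> S"
    by metis
  show ?thesis
  proof (rule that[of "\<lambda>k. p + s k *\<^sub>R (v + \<kappa> k *\<^sub>R F p)" s])
    show "s \<longlonglongrightarrow> 0"
      by (rule Lim_null_comparison[OF _ LIMSEQ_inverse_real_of_nat])
         (use * in \<open>auto intro!: always_eventually simp: less_imp_le\<close>)
    have "\<kappa> \<longlonglongrightarrow> 0"
      by (rule Lim_null_comparison[OF _ LIMSEQ_inverse_real_of_nat])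
         (use * in \<open>auto intro!: always_eventually\<close>)
    then have "(\<lambda>k. v + \<kappa> k *\<^sub>R F p) \<longlonglongrightarrow> v + 0 *\<^sub>R F p"
      by (intro tendsto_intros)
    moreover have "(1 / s k) *\<^sub>R (p + s k *\<^sub>R (v + \<kappa> k *\<^sub>R F p) - p) = v + \<kappa> k *\<^sub>R F p" for k
      using *(1)[of k] by simp
    ultimately show "(\<lambda>k. (1 / s k) *\<^sub>R (p + s k *\<^sub>R (v + \<kappa> k *\<^sub>R F p) - p)) \<longlonglongrightarrow> v"
      by simp
  qed (use * in auto)
qed

text \<open>A linear functional with a maximum on \<open>S\<close> at \<open>p\<close> is nonpositive on all tangent vectors, hence zero on
  them.\<close>

lemma normal_parallel_gradient:
  assumes p: "p \<in> S" "p \<in> U" and n: "\<And>y. y \<in> S \<Longrightarrow> n \<bullet> y \<le> n \<bullet> p"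
  obtains a where "n = a *\<^sub>R F p"
proof -
  have le: "n \<bullet> v \<le> 0" if v: "F p \<bullet> v = 0" for v
  proof -
    obtain y and s :: "nat \<Rightarrow> real" where y: "\<And>k. y k \<in> S" "\<And>k. s k > 0"
      "(\<lambda>k. (1 / s k) *\<^sub>R (y k - p)) \<longlonglongrightarrow> v"
      using tangent_sequence[OF p v] by metis
    have "(\<lambda>k. n \<bullet> ((1 / s k) *\<^sub>R (y k - p))) \<longlonglongrightarrow> n \<bullet> v"
      by (intro tendsto_intros y)
    moreover have "n \<bullet> ((1 / s k) *\<^sub>R (y k - p)) \<le> 0" for k
      using n[OF y(1)[of k]] y(2)[of k] by (simp add: inner_diff_right divide_nonpos_pos)
    ultimately show ?thesis by (meson LIMSEQ_le_const2)
  qed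
  define a where "a = (n \<bullet> F p) / (F p \<bullet> F p)"
  define v where "v = n - a *\<^sub>R F p"
  have v: "F p \<bullet> v = 0"
    using F_nonzero[OF p] by (simp add: v_def a_def inner_diff_right inner_commute)
  have "v \<bullet> v = n \<bullet> v" using v by (simp add: v_def inner_diff_left inner_commute)
  also have "\<dots> \<le> 0" using le[OF v] .
  finally have "v = 0" by (metis inner_gt_zero_iff linorder_not_le)
  then show ?thesis using that[of a] by (simp add: v_def)
qed

lemma F_Lipschitz_near:
  assumes "p \<in> U"
  obtains C d where "C > 0" "d > 0" "cball p d \<subseteq> U"
    "\<And>x y. x \<in> cball p d \<Longrightarrow> y \<in> cball p d \<Longrightarrow> norm (F x - F y) \<le> C * norm (x - y)"
proof -
  obtain d where d: "d > 0" "cball p d \<subseteq> U" using open_U assms by (meson open_contains_cball)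
  have "\<exists>B. \<forall>x\<in>cball p d. norm (F' x b) \<le> B" for b
  proof -
    have "compact ((\<lambda>x. F' x b) ` cball p d)"
      using F'_cont d by (intro compact_continuous_image continuous_on_subset[OF F'_cont]) auto
    then show ?thesis by (meson bounded_iff compact_imp_bounded imageI)
  qed
  then obtain B where B: "\<And>b x. x \<in> cball p d \<Longrightarrow> norm (F' x b) \<le> B b" by metis
  define C where "C = (\<Sum>b\<in>Basis. \<bar>B b\<bar>) + 1"
  have C: "C > 0" by (simp add: C_def sum_nonneg add_nonneg_pos)
  have bound: "norm (F' x h) \<le> C * norm h" if x: "x \<in> cball p d" for x h
  proof -
    have xU: "x \<in> U" using x d by blast
    have "F' x h = (\<Sum>b\<in>Basis. (h \<bullet> b) *\<^sub>R F' x b)"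
      using linear_F'[OF xU]
      by (subst (1) euclidean_representation[of h, symmetric]) (simp add: linear_sum linear_cmul)
    also have "norm \<dots> \<le> (\<Sum>b\<in>Basis. \<bar>B b\<bar> * norm h)"
    proof (intro sum_norm_le)
      fix b :: 'a assume b: "b \<in> Basis"
      have "norm ((h \<bullet> b) *\<^sub>R F' x b) = \<bar>h \<bullet> b\<bar> * norm (F' x b)" by simp
      also have "\<dots> \<le> norm h * \<bar>B b\<bar>"
        using Basis_le_norm[OF b, of h] B[OF x, of b] by (intro mult_mono) auto
      finally show "norm ((h \<bullet> b) *\<^sub>R F' x b) \<le> \<bar>B b\<bar> * norm h" by (simp add: mult.commute)
    qed
    also have "\<dots> \<le> C * norm h" by (simp add: C_def sum_distrib_right[symmetric] distrib_right)
    finally show ?thesis .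
  qed
  have "norm (F x - F y) \<le> C * norm (x - y)" if "x \<in> cball p d" "y \<in> cball p d" for x y
  proof (rule differentiable_bound[of "cball p d" F F'])
    show "(F has_derivative F' x) (at x within cball p d)" if "x \<in> cball p d" for x
      using that d F_deriv has_derivative_at_withinI by blast
    show "onorm (F' x) \<le> C" if "x \<in> cball p d" for x
      using bound[OF that] C by (intro onorm_bound) auto
  qed (use that in auto)
  then show ?thesis using that C d by blast
qed

text \<open>The gradient is Lipschitz near \<open>p0\<close>, so \<open>f\<close> deviates from its linearization at \<open>p\<close> by at most
  \<open>C * (norm h)\<^sup>2\<close> for a displacement \<open>h\<close>. On a ball of radius \<open>r\<close> touching the tangent plane at \<open>p\<close> the linearization
  has size more than \<open>norm (F p) * (norm h)\<^sup>2 / (2 r)\<close>, which wins if \<open>r\<close> is small. The radius is uniform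
  for \<open>p\<close> near \<open>p0\<close>.\<close>

lemma touching_balls_avoid:
  assumes p0: "p0 \<in> S" "p0 \<in> U"
  obtains r d where "r > 0" "d > 0" "ball p0 d \<subseteq> U"
    "\<And>p y. p \<in> S \<Longrightarrow> p \<in> ball p0 d \<Longrightarrow> dist y (p + r *\<^sub>R sgn (F p)) < r \<Longrightarrow> y \<notin> S"
    "\<And>p y. p \<in> S \<Longrightarrow> p \<in> ball p0 d \<Longrightarrow> dist y (p - r *\<^sub>R sgn (F p)) < r \<Longrightarrow> y \<notin> S"
proof -
  obtain C e where C: "C > 0" "e > 0" "cball p0 e \<subseteq> U"
    "\<And>x y. x \<in> cball p0 e \<Longrightarrow> y \<in> cball p0 e \<Longrightarrow> norm (F x - F y) \<le> C * norm (x - y)"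
    using F_Lipschitz_near[OF p0(2)] by metis
  define g where "g = norm (F p0) / 2"
  have g: "g > 0" using F_nonzero[OF p0] by (simp add: g_def)
  define d where "d = min (e / 2) (g / C)"
  define r where "r = min (e / 4) (g / (2 * C))"
  have d: "d > 0" "d \<le> e / 2" "C * d \<le> g" and r: "r > 0" "r \<le> e / 4" "2 * (r * C) \<le> g"
    using C(1,2) g by (auto simp: d_def r_def field_simps min_def)
  have main: "y \<notin> S" if p: "p \<in> S" "p \<in> ball p0 d" and y: "dist y (p + (\<sigma> * r) *\<^sub>R sgn (F p)) < r"
    and \<sigma>: "\<sigma> = 1 \<or> \<sigma> = - 1" for p y \<sigma>
  proof
    assume yS: "y \<in> S"
    have pe: "p \<in> cball p0 e" using p d by auto
    have "p \<in> U" using pe C by blast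
    then have Fp: "F p \<noteq> 0" using F_nonzero p by blast
    have gp: "norm (F p) \<ge> g"
    proof -
      have "norm (F p0 - F p) \<le> C * norm (p0 - p)" using C pe by auto
      also have "\<dots> \<le> C * d" using p C by (intro mult_left_mono) (auto simp: dist_norm)
      also have "\<dots> \<le> g" by (rule d)
      finally show ?thesis using norm_triangle_ineq2[of "F p0" "F p"] by (simp add: g_def)
    qed
    define h where "h = y - p"
    have hr: "norm h \<le> 2 * r"
    proof -
      have "norm h \<le> dist y (p + (\<sigma> * r) *\<^sub>R sgn (F p)) + norm ((\<sigma> * r) *\<^sub>R sgn (F p))"
        unfolding h_def dist_norm using norm_triangle_ineq[of "y - (p + (\<sigma> * r) *\<^sub>R sgn (F p))" "(\<sigma> * r) *\<^sub>R sgn (F p)"]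
        by simp
      also have "\<dots> \<le> r + r" using y \<sigma> r Fp by (intro add_mono) (auto simp: norm_sgn)
      finally show ?thesis by simp
    qed
    have *: "norm (h - (\<sigma> * r) *\<^sub>R sgn (F p)) ^ 2 < r ^ 2"
      using y r by (intro power_strict_mono) (auto simp: h_def dist_norm algebra_simps)
    then have sq: "(norm h)\<^sup>2 < 2 * r * (\<sigma> * (sgn (F p) \<bullet> h))"
    proof -
      have "norm (sgn (F p)) = 1" "(\<sigma> * r)\<^sup>2 = r\<^sup>2" using Fp \<sigma> by (auto simp: norm_sgn)
      then have "(norm (h - (\<sigma> * r) *\<^sub>R sgn (F p)))\<^sup>2 = (norm h)\<^sup>2 - 2 * (\<sigma> * r) * (sgn (F p) \<bullet> h) + r\<^sup>2"
        using norm_scaleR_add_power2[of 1 h "- (\<sigma> * r)" "sgn (F p)"] by simp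
      with * show ?thesis by (simp add: mult.assoc mult.left_commute)
    qed
    have seg: "closed_segment p y \<subseteq> cball p0 e"
    proof -
      have "dist p0 y \<le> dist p0 p + norm h" unfolding h_def by (metis dist_commute dist_norm dist_triangle)
      then have "y \<in> cball p0 e" using p hr d r by auto
      then show ?thesis using pe by (simp add: closed_segment_subset)
    qed
    obtain z where z: "z \<in> closed_segment p y" "f y - f p = F z \<bullet> h"
      using f_mean_value[of p y] seg C(3) unfolding h_def by blast
    have "y \<in> U" "p \<in> U" using seg C(3) by auto
    then have "f y - f p = 0" using yS p in_S_iff[of y] in_S_iff[of p] by auto
    then have "F p \<bullet> h = (F p - F z) \<bullet> h" using z(2) by (simp add: inner_diff_left)
    then have "\<bar>F p \<bullet> h\<bar> \<le> norm (F p - F z) * norm h" using Cauchy_Schwarz_ineq2 by metis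
    also have "\<dots> \<le> (C * norm h) * norm h"
    proof (intro mult_right_mono)
      have "norm (F p - F z) \<le> C * norm (p - z)" using C z(1) seg pe by blast
      also have "\<dots> \<le> C * norm h"
        using C segment_bound1[OF z(1)] by (intro mult_left_mono) (auto simp: h_def norm_minus_commute)
      finally show "norm (F p - F z) \<le> C * norm h" .
    qed simp
    finally have A: "\<bar>F p \<bullet> h\<bar> \<le> C * (norm h)\<^sup>2" by (simp add: power2_eq_square)
    have "F p \<bullet> h = norm (F p) * (sgn (F p) \<bullet> h)"
      using Fp by (simp add: sgn_div_norm)
    then have "g * (norm h)\<^sup>2 \<le> norm (F p) * (norm h)\<^sup>2" "norm (F p) * (norm h)\<^sup>2 < norm (F p) * (2 * r * (\<sigma> * (sgn (F p) \<bullet> h)))"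
      "norm (F p) * (2 * r * (\<sigma> * (sgn (F p) \<bullet> h))) = 2 * r * (\<sigma> * (F p \<bullet> h))"
      using gp Fp sq by (auto intro!: mult_right_mono)
    moreover have "2 * r * (\<sigma> * (F p \<bullet> h)) \<le> 2 * r * \<bar>F p \<bullet> h\<bar>"
      using \<sigma> r by auto
    moreover have "2 * r * \<bar>F p \<bullet> h\<bar> \<le> 2 * r * (C * (norm h)\<^sup>2)"
      using A r by (intro mult_left_mono) auto
    moreover have "2 * (r * C) * (norm h)\<^sup>2 \<le> g * (norm h)\<^sup>2"
      using r by (intro mult_right_mono) auto
    ultimately show False by (simp add: algebra_simps)
  qed
  show ?thesis
  proof (rule that[OF r(1) d(1)])
    show "ball p0 d \<subseteq> U" using d C(2,3) by (auto simp: subset_iff)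
    show "y \<notin> S" if "p \<in> S" "p \<in> ball p0 d" "dist y (p + r *\<^sub>R sgn (F p)) < r" for p y
      using main[of p y 1] that by simp
    show "y \<notin> S" if "p \<in> S" "p \<in> ball p0 d" "dist y (p - r *\<^sub>R sgn (F p)) < r" for p y
      using main[of p y "- 1"] that by simp
  qed
qed

end

lemma C2_chart_scale:
  assumes "C2_chart S U f F F'" and "c \<noteq> 0"
  shows "C2_chart S U (\<lambda>x. c * f x) (\<lambda>x. c *\<^sub>R F x) (\<lambda>x v. c *\<^sub>R F' x v)"
proof -
  interpret C2_chart S U f F F' by (rule assms)
  show ?thesis
  proof
    show "((\<lambda>x. c * f x) has_derivative (\<lambda>v. c *\<^sub>R F x \<bullet> v)) (at x)" if "x \<in> U" for x
      using has_derivative_mult_right[OF f_deriv[OF that], of c] by simp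
    show "((\<lambda>x. c *\<^sub>R F x) has_derivative (\<lambda>v. c *\<^sub>R F' x v)) (at x)" if "x \<in> U" for x
      using has_derivative_scaleR_right[OF F_deriv[OF that], of c] by simp
    show "continuous_on U (\<lambda>x. c *\<^sub>R F' x v)" for v
      by (intro continuous_on_scaleR continuous_on_const F'_cont)
    show "S \<inter> U = {x \<in> U. c * f x = 0}" using S_eq assms(2) by simp
    show "c *\<^sub>R F x \<noteq> 0" if "x \<in> S" "x \<in> U" for x using F_nonzero that assms(2) by simp
  qed (rule open_U)
qed

lemma C2_chart_exists:
  fixes S :: "'a::euclidean_space set"
  assumes "Ck_hypersurface 3 S" "p \<in> S"
  obtains U f F F' where "C2_chart S U f F F'" "p \<in> U"
proof -
  have "\<exists>U f. open U \<and> p \<in> U \<and> Ck_on 3 U f \<and> S \<inter> U = {x \<in> U. f x = 0} \<and>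
      (\<forall>x\<in>S \<inter> U. frechet_derivative f (at x) \<noteq> (\<lambda>v. 0))"
    using assms(1)[unfolded Ck_hypersurface_def] assms(2) by (rule bspec)
  then obtain U f where U: "open U" "p \<in> U" and C: "Ck_on 3 U f"
    and S: "S \<inter> U = {x \<in> U. f x = 0}" "\<forall>x\<in>S \<inter> U. frechet_derivative f (at x) \<noteq> (\<lambda>v. 0)"
    by (elim exE conjE)
  define D where "D x v = frechet_derivative f (at x) v" for x v
  define DD where "DD b x v = frechet_derivative (\<lambda>x. D x b) (at x) v" for b x v
  have diff: "f differentiable (at x)" "(\<lambda>x. D x b) differentiable (at x)"
    "(\<lambda>x. DD b x v) differentiable (at x)" if "x \<in> U" for x b v
    using C that by (auto simp: numeral_3_eq_3 D_def DD_def)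
  have Df: "(f has_derivative D x) (at x)" if "x \<in> U" for x
    using diff(1)[OF that] unfolding D_def[abs_def] by (simp add: frechet_derivative_works)
  have DDf: "((\<lambda>x. D x b) has_derivative DD b x) (at x)" if "x \<in> U" for x b
    using diff(2)[OF that] unfolding DD_def[abs_def] by (simp add: frechet_derivative_works)
  define F where "F x = (\<Sum>b\<in>Basis. D x b *\<^sub>R b)" for x
  define F' where "F' x v = (\<Sum>b\<in>Basis. DD b x v *\<^sub>R b)" for x v
  have D_F: "D x = (\<lambda>v. F x \<bullet> v)" if "x \<in> U" for x
  proof
    fix v
    have lin: "linear (D x)" using Df[OF that] has_derivative_linear by blast
    have "D x v = (\<Sum>b\<in>Basis. (v \<bullet> b) * D x b)"
      using lin by (subst (1) euclidean_representation[of v, symmetric]) (simp add: linear_sum linear_cmul)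
    then show "D x v = F x \<bullet> v"
      by (simp add: F_def inner_sum_left inner_commute[of v] mult.commute)
  qed
  have "C2_chart S U f F F'"
  proof
    show "(f has_derivative (\<lambda>v. F x \<bullet> v)) (at x)" if "x \<in> U" for x
      using Df[OF that] D_F[OF that] by simp
    show "(F has_derivative F' x) (at x)" if "x \<in> U" for x
      unfolding F_def[abs_def] F'_def[abs_def]
      by (intro has_derivative_sum has_derivative_scaleR_left DDf that)
    show "continuous_on U (\<lambda>x. F' x v)" for v
      unfolding F'_def using diff(3)
      by (intro continuous_intros)
         (meson continuous_at_imp_continuous_on differentiable_imp_continuous_within)
    show "F x \<noteq> 0" if "x \<in> S" "x \<in> U" for x
      using bspec[OF S(2), of x] that D_F[of x] by (auto simp: D_def fun_eq_iff)
  qed (rule U S(1))+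
  then show ?thesis using that U by blast
qed

section \<open>Outer normals and touching balls\<close>

definition outer_normal :: "'a::euclidean_space set \<Rightarrow> 'a \<Rightarrow> 'a \<Rightarrow> bool" where
  "outer_normal K p n \<longleftrightarrow> norm n = 1 \<and> (\<forall>y\<in>K. n \<bullet> y \<le> n \<bullet> p)"

lemma outer_normal_exists:
  fixes K :: "'a::euclidean_space set"
  assumes "convex K" "closed K" "interior K \<noteq> {}" "p \<in> frontier K"
  obtains n where "outer_normal K p n"
proof -
  have "p \<in> K" "p \<notin> rel_interior K"
    using assms by (auto simp: frontier_def rel_interior_nonempty_interior)
  then obtain a where a: "a \<noteq> 0" "\<And>y. y \<in> K \<Longrightarrow> a \<bullet> p \<le> a \<bullet> y"
    using supporting_hyperplane_rel_boundary[OF assms(1)] by metis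
  have "outer_normal K p (- sgn a)"
    using a by (simp add: outer_normal_def norm_sgn sgn_div_norm divide_right_mono)
  then show ?thesis using that by blast
qed

lemma interior_strictly_below_normal:
  assumes "x \<in> interior K" "outer_normal K p n"
  shows "n \<bullet> x < n \<bullet> p"
proof -
  obtain e where e: "e > 0" "cball x e \<subseteq> K" using assms(1) by (auto simp: mem_interior_cball)
  have n: "norm n = 1" "\<And>y. y \<in> K \<Longrightarrow> n \<bullet> y \<le> n \<bullet> p"
    using assms(2) by (auto simp: outer_normal_def)
  have "x + e *\<^sub>R n \<in> K" using e n by (intro subsetD[OF e(2)]) (simp add: dist_norm)
  from n(2)[OF this] have "n \<bullet> x + e * (n \<bullet> n) \<le> n \<bullet> p" by (simp add: inner_add_right)
  then show ?thesis using e n by (simp add: norm_eq_1)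
qed

text \<open>Each of the two touching balls is connected and misses the boundary, so it lies inside \<open>K\<close> or outside.
  A segment from \<open>p\<close> to a point of \<open>K\<close> off the tangent plane enters one of them.\<close>

lemma interior_ball_of_touching_balls:
  fixes K :: "'a::euclidean_space set"
  assumes K: "convex K" "closed K" "x0 \<in> interior K" and p: "p \<in> K"
    and \<nu>: "norm \<nu> = 1" and r: "r > 0"
    and avoid: "ball (p + r *\<^sub>R \<nu>) r \<inter> frontier K = {}" "ball (p - r *\<^sub>R \<nu>) r \<inter> frontier K = {}"
  obtains n where "norm n = 1" "cball (p - r *\<^sub>R n) r \<subseteq> K"
proof -
  obtain e where e: "e > 0" "cball x0 e \<subseteq> K" using K by (auto simp: mem_interior_cball)
  have "\<exists>z\<in>K. \<nu> \<bullet> (z - p) \<noteq> 0"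
  proof (cases "\<nu> \<bullet> (x0 - p) = 0")
    case True
    then have "\<nu> \<bullet> (x0 + e *\<^sub>R \<nu> - p) = e"
      using \<nu> by (simp add: inner_add_right inner_diff_right norm_eq_1)
    moreover have "x0 + e *\<^sub>R \<nu> \<in> K"
      using e \<nu> by (intro subsetD[OF e(2)]) (simp add: dist_norm)
    ultimately show ?thesis using e by force
  next
    case False
    moreover have "x0 \<in> K" using K interior_subset by blast
    ultimately show ?thesis by blast
  qed
  then obtain z where z: "z \<in> K" "\<nu> \<bullet> (z - p) \<noteq> 0" by blast
  define a where "a = \<nu> \<bullet> (z - p)"
  define n where "n = - sgn a *\<^sub>R \<nu>"
  have n: "norm n = 1" using \<nu> z by (simp add: n_def a_def abs_sgn_eq)
  have na: "n \<bullet> (z - p) = - \<bar>a\<bar>"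
    by (simp add: n_def a_def[symmetric] abs_sgn mult.commute)
  have zp: "(norm (z - p))\<^sup>2 > 0" using z by auto
  define s where "s = min 1 (r * \<bar>a\<bar> / (norm (z - p))\<^sup>2)"
  have s: "0 < s" "s \<le> 1" "s * (norm (z - p))\<^sup>2 \<le> r * \<bar>a\<bar>"
  proof -
    have "r * \<bar>a\<bar> / (norm (z - p))\<^sup>2 > 0" using zp r z by (simp add: a_def)
    then show "0 < s" "s \<le> 1" by (simp_all add: s_def)
    have "s \<le> r * \<bar>a\<bar> / (norm (z - p))\<^sup>2" by (simp add: s_def)
    then show "s * (norm (z - p))\<^sup>2 \<le> r * \<bar>a\<bar>" using zp by (simp only: pos_le_divide_eq)
  qed
  define y where "y = p + s *\<^sub>R (z - p)"
  have yK: "y \<in> K"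
    using convexD_alt[OF K(1) p z(1), of s] s by (simp add: y_def algebra_simps)
  have "(norm (s *\<^sub>R (z - p) + r *\<^sub>R n))\<^sup>2
      = s\<^sup>2 * (norm (z - p))\<^sup>2 + 2 * (s * r) * (n \<bullet> (z - p)) + r\<^sup>2 * (norm n)\<^sup>2"
    by (rule norm_scaleR_add_power2)
  also have "\<dots> = s * (s * (norm (z - p))\<^sup>2 - 2 * (r * \<bar>a\<bar>)) + r\<^sup>2"
    unfolding n na by (simp add: power2_eq_square algebra_simps)
  also have "\<dots> < r\<^sup>2"
  proof -
    have "r * \<bar>a\<bar> > 0" using r z by (simp add: a_def)
    then have "s * (norm (z - p))\<^sup>2 - 2 * (r * \<bar>a\<bar>) < 0" using s by linarith
    then show ?thesis using s by (simp add: mult_pos_neg)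
  qed
  finally have "norm (s *\<^sub>R (z - p) + r *\<^sub>R n) < r"
    by (rule power2_less_imp_less) (use r in simp)
  then have yb: "y \<in> ball (p - r *\<^sub>R n) r"
    by (simp add: y_def dist_norm norm_minus_commute algebra_simps)
  have nn: "n = \<nu> \<or> n = - \<nu>" using z by (auto simp: n_def a_def sgn_if)
  have av: "ball (p - r *\<^sub>R n) r \<inter> frontier K = {}" using nn avoid by auto
  have "ball (p - r *\<^sub>R n) r \<subseteq> K"
  proof (rule ccontr)
    assume "\<not> ?thesis"
    then have "ball (p - r *\<^sub>R n) r - K \<noteq> {}" by blast
    with connected_Int_frontier[OF connected_ball, of "p - r *\<^sub>R n" r K] yb yK av show False by blast
  qed
  then have "closure (ball (p - r *\<^sub>R n) r) \<subseteq> K" using K(2) by (rule closure_minimal)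
  then show ?thesis using that n r by (simp add: closure_ball)
qed

lemma locally_uniform_interior_ball:
  fixes K :: "'a::euclidean_space set"
  assumes K: "Ck_convex_body 3 K" and p0: "p0 \<in> frontier K"
  obtains r d where "r > 0" "d > 0"
    "\<And>p. p \<in> frontier K \<Longrightarrow> p \<in> ball p0 d \<Longrightarrow> \<exists>n. norm n = 1 \<and> cball (p - r *\<^sub>R n) r \<subseteq> K"
proof -
  have K': "convex K" "closed K" "interior K \<noteq> {}" "Ck_hypersurface 3 (frontier K)"
    using K by (auto simp: Ck_convex_body_def convex_body_def compact_imp_closed)
  then obtain x0 where x0: "x0 \<in> interior K" by blast
  obtain U f F F' where "C2_chart (frontier K) U f F F'" and U: "p0 \<in> U"
    using C2_chart_exists[OF K'(4) p0] by metis
  then interpret C2_chart "frontier K" U f F F' by simp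
  obtain r d where r: "r > 0" "d > 0" "ball p0 d \<subseteq> U"
    "\<And>p y. p \<in> frontier K \<Longrightarrow> p \<in> ball p0 d \<Longrightarrow> dist y (p + r *\<^sub>R sgn (F p)) < r \<Longrightarrow> y \<notin> frontier K"
    "\<And>p y. p \<in> frontier K \<Longrightarrow> p \<in> ball p0 d \<Longrightarrow> dist y (p - r *\<^sub>R sgn (F p)) < r \<Longrightarrow> y \<notin> frontier K"
    using touching_balls_avoid[OF p0 U] by metis
  have "\<exists>n. norm n = 1 \<and> cball (p - r *\<^sub>R n) r \<subseteq> K" if p: "p \<in> frontier K" "p \<in> ball p0 d" for p
  proof -
    have "p \<in> K" using p K' by (simp add: frontier_def)
    moreover have "norm (sgn (F p)) = 1"
    proof -
      have "p \<in> U" using p(2) r(3) by blast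
      then show ?thesis using F_nonzero[OF p(1)] by (simp add: norm_sgn)
    qed
    moreover have "y \<notin> frontier K" if "y \<in> ball (p + r *\<^sub>R sgn (F p)) r" for y
      using r(4)[OF p, of y] that by (simp add: dist_commute)
    then have "ball (p + r *\<^sub>R sgn (F p)) r \<inter> frontier K = {}" by blast
    moreover have "y \<notin> frontier K" if "y \<in> ball (p - r *\<^sub>R sgn (F p)) r" for y
      using r(5)[OF p, of y] that by (simp add: dist_commute)
    then have "ball (p - r *\<^sub>R sgn (F p)) r \<inter> frontier K = {}" by blast
    ultimately obtain n where "norm n = 1" "cball (p - r *\<^sub>R n) r \<subseteq> K"
      using interior_ball_of_touching_balls[OF K'(1,2) x0 _ _ r(1)] by blast
    then show ?thesis by blast
  qed
  then show ?thesis using that r by blast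
qed


section \<open>Strong convexity at a curved boundary point\<close>

text \<open>The defining function is normalized so that its gradient at \<open>p0\<close> is the outer unit normal \<open>u\<close>.\<close>

locale convex_chart = C2_chart "frontier K" U f F F'
  for K U :: "'a::euclidean_space set" and f F F' +
  fixes p0 u :: 'a
  assumes convex_K: "convex K" and compact_K: "compact K" and interior_K: "interior K \<noteq> {}"
    and p0: "p0 \<in> frontier K" "p0 \<in> U"
    and u_normal: "outer_normal K p0 u"
    and F_p0: "F p0 = u"
begin

lemma norm_u: "norm u = 1"
  using u_normal by (simp add: outer_normal_def)

lemma frontier_subset: "frontier K \<subseteq> K"
  using compact_K by (simp add: compact_imp_closed frontier_subset_closed)

text \<open>Normals are parallel to the gradient; the sign is fixed by an interior point \<open>x0\<close>, towards which
  the gradient cannot point.\<close>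

lemma outer_normal_near:
  obtains d where "d > 0" "ball p0 d \<subseteq> U"
    "\<And>p n. p \<in> frontier K \<Longrightarrow> p \<in> ball p0 d \<Longrightarrow> outer_normal K p n \<longleftrightarrow> n = sgn (F p)"
    "\<And>p. p \<in> ball p0 d \<Longrightarrow> norm (F p) < 2"
proof -
  obtain x0 where x0: "x0 \<in> interior K" using interior_K by blast
  have contF: "isCont F p0"
    using F_continuous open_U p0 by (simp add: continuous_on_eq_continuous_at)
  have "F p0 \<bullet> (p0 - x0) > 0"
    using interior_strictly_below_normal[OF x0 u_normal] by (simp add: F_p0 inner_diff_right)
  moreover have "isCont (\<lambda>x. F x \<bullet> (x - x0)) p0" by (intro continuous_intros contF)
  then have "((\<lambda>x. F x \<bullet> (x - x0)) \<longlongrightarrow> F p0 \<bullet> (p0 - x0)) (nhds p0)"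
    unfolding isCont_def by (rule tendsto_at_iff_tendsto_nhds[of "\<lambda>x. F x \<bullet> (x - x0)" p0, THEN iffD1])
  ultimately have 1: "\<forall>\<^sub>F x in nhds p0. F x \<bullet> (x - x0) > 0"
    by (rule order_tendstoD(1)[rotated])
  have "norm (F p0) < 2" by (simp add: F_p0 norm_u)
  moreover have "isCont (\<lambda>x. norm (F x)) p0" by (intro continuous_intros contF)
  then have "((\<lambda>x. norm (F x)) \<longlongrightarrow> norm (F p0)) (nhds p0)"
    unfolding isCont_def by (rule tendsto_at_iff_tendsto_nhds[of "\<lambda>x. norm (F x)" p0, THEN iffD1])
  ultimately have 2: "\<forall>\<^sub>F x in nhds p0. norm (F x) < 2"
    by (rule order_tendstoD(2)[rotated])
  have 3: "\<forall>\<^sub>F x in nhds p0. x \<in> U" using open_U p0 by (simp add: eventually_nhds_in_open)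
  from 1 2 3 have "\<forall>\<^sub>F x in nhds p0. F x \<bullet> (x - x0) > 0 \<and> norm (F x) < 2 \<and> x \<in> U"
    by (simp add: eventually_conj_iff)
  then obtain d where d: "d > 0" "\<And>x. dist x p0 < d \<Longrightarrow> F x \<bullet> (x - x0) > 0 \<and> norm (F x) < 2 \<and> x \<in> U"
    unfolding eventually_nhds_metric by blast
  have imp: "n = sgn (F p)" if p: "p \<in> frontier K" "p \<in> ball p0 d" and n: "outer_normal K p n" for p n
  proof -
    have dp: "F p \<bullet> (p - x0) > 0" "p \<in> U" using d(2)[of p] p by (auto simp: dist_commute)
    obtain a where a: "n = a *\<^sub>R F p"
      using normal_parallel_gradient[OF p(1) dp(2), of n] n frontier_subset by (auto simp: outer_normal_def)
    have "0 < n \<bullet> (p - x0)" using interior_strictly_below_normal[OF x0 n] by (simp add: inner_diff_right)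
    then have "a > 0" using dp a by (simp add: zero_less_mult_iff)
    moreover have "norm n = 1" using n by (simp add: outer_normal_def)
    ultimately have "a * norm (F p) = 1" using a by simp
    moreover from this have "norm (F p) \<noteq> 0" by auto
    ultimately have "a = 1 / norm (F p)" by (simp add: eq_divide_eq)
    then show ?thesis using a by (simp add: sgn_div_norm divide_inverse)
  qed
  show ?thesis
  proof (rule that[OF d(1)])
    show "ball p0 d \<subseteq> U" "\<And>p. p \<in> ball p0 d \<Longrightarrow> norm (F p) < 2"
      using d(2) by (auto simp: dist_commute)
    show "outer_normal K p n \<longleftrightarrow> n = sgn (F p)" if p: "p \<in> frontier K" "p \<in> ball p0 d" for p n
      using imp[OF p] outer_normal_exists[OF convex_K compact_imp_closed[OF compact_K] interior_K p(1)] by metis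
  qed
qed

lemma gradient_is_normal:
  assumes "outer_normal K p (sgn (F p))" "y \<in> K"
  shows "F p \<bullet> y \<le> F p \<bullet> p"
proof -
  have "norm (F p) * (sgn (F p) \<bullet> y) \<le> norm (F p) * (sgn (F p) \<bullet> p)"
    using assms by (intro mult_left_mono) (auto simp: outer_normal_def)
  then show ?thesis by (cases "F p = 0") (simp_all add: sgn_div_norm)
qed

text \<open>Outer normals of a convex set are monotone, and near \<open>p0\<close> the gradient \<open>F\<close> is an outer normal.
  Divide \<open>(F y - F p0) \<bullet> (y - p0) \<ge> 0\<close> by \<open>s\<^sup>2\<close> along a tangent sequence.\<close>

lemma F'_positive_semidefinite:
  assumes v: "u \<bullet> v = 0"
  shows "F' p0 v \<bullet> v \<ge> 0"
proof -
  obtain d where d: "d > 0" "ball p0 d \<subseteq> U"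
    "\<And>p n. p \<in> frontier K \<Longrightarrow> p \<in> ball p0 d \<Longrightarrow> outer_normal K p n \<longleftrightarrow> n = sgn (F p)"
    using outer_normal_near by metis
  obtain y and s :: "nat \<Rightarrow> real" where y: "\<And>k. y k \<in> frontier K" "\<And>k. s k > 0" "s \<longlonglongrightarrow> 0"
    "(\<lambda>k. (1 / s k) *\<^sub>R (y k - p0)) \<longlonglongrightarrow> v"
    using tangent_sequence[OF p0, of v] v F_p0 by auto
  have "y \<longlonglongrightarrow> p0" using tangent_sequence_tendsto y(2-4) .
  then have "\<forall>\<^sub>F k in sequentially. y k \<in> ball p0 d"
    using d(1) by (intro topological_tendstoD) auto
  then have "\<forall>\<^sub>F k in sequentially. ((1 / s k) *\<^sub>R (F (y k) - F p0)) \<bullet> ((1 / s k) *\<^sub>R (y k - p0)) \<ge> 0"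
  proof eventually_elim
    case (elim k)
    have "F (y k) \<bullet> p0 \<le> F (y k) \<bullet> y k"
      using d(3)[OF y(1) elim] p0(1) frontier_subset by (intro gradient_is_normal) auto
    moreover have "u \<bullet> y k \<le> u \<bullet> p0"
      using u_normal y(1) frontier_subset by (auto simp: outer_normal_def)
    ultimately have "0 \<le> (F (y k) - F p0) \<bullet> (y k - p0)"
      by (simp add: F_p0 inner_diff_left inner_diff_right)
    then show ?case
      using y(2)[of k] by (simp only: inner_scaleR_left inner_scaleR_right) (intro mult_nonneg_nonneg, auto)
  qed
  moreover have "(\<lambda>k. ((1 / s k) *\<^sub>R (F (y k) - F p0)) \<bullet> ((1 / s k) *\<^sub>R (y k - p0))) \<longlonglongrightarrow> F' p0 v \<bullet> v"
    by (rule tendsto_inner[OF has_derivative_along_tangent_sequence[OF F_deriv[OF p0(2)] UNIV_I y(2-4)] y(4)])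
  ultimately show ?thesis
    by (simp add: tendsto_lowerbound)
qed

text \<open>Near \<open>p0\<close> the Gauss map is the normalized gradient; normalization removes the component of the
  derivative in the direction \<open>u\<close>.\<close>

lemma gauss_map_derivative:
  "(gauss_map K has_derivative (\<lambda>h. F' p0 h - (u \<bullet> F' p0 h) *\<^sub>R u)) (at p0 within frontier K)"
proof -
  obtain d where d: "d > 0" "ball p0 d \<subseteq> U"
    "\<And>p n. p \<in> frontier K \<Longrightarrow> p \<in> ball p0 d \<Longrightarrow> outer_normal K p n \<longleftrightarrow> n = sgn (F p)"
    using outer_normal_near by metis
  have nz: "F p0 \<noteq> 0" using F_p0 norm_u by auto
  have su: "sgn u = u" by (simp add: sgn_div_norm norm_u)
  have norm: "((\<lambda>x. norm (F x)) has_derivative (\<lambda>h. u \<bullet> F' p0 h)) (at p0)"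
    using has_derivative_compose[OF F_deriv[OF p0(2)] has_derivative_norm[OF nz]]
    by (simp add: F_p0 su inner_commute)
  have "((\<lambda>x. inverse (norm (F x))) has_derivative (\<lambda>h. - (inverse (norm (F p0)) * (u \<bullet> F' p0 h) * inverse (norm (F p0))))) (at p0)"
    using Deriv.has_derivative_inverse[OF _ norm] nz by simp
  then have "((\<lambda>x. inverse (norm (F x)) *\<^sub>R F x) has_derivative (\<lambda>h. F' p0 h - (u \<bullet> F' p0 h) *\<^sub>R u)) (at p0)"
    using has_derivative_scaleR[OF _ F_deriv[OF p0(2)]] by (force simp: F_p0 norm_u)
  then have "((\<lambda>x. sgn (F x)) has_derivative (\<lambda>h. F' p0 h - (u \<bullet> F' p0 h) *\<^sub>R u)) (at p0 within frontier K)"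
    by (simp add: sgn_div_norm has_derivative_at_withinI)
  then show ?thesis
  proof (rule has_derivative_transform_within)
    fix p assume "p \<in> frontier K" "dist p p0 < d"
    then have "outer_normal K p n \<longleftrightarrow> n = sgn (F p)" for n using d(3)[of p n] by (simp add: dist_commute)
    then show "sgn (F p) = gauss_map K p"
      unfolding gauss_map_def outer_normal_def by simp
  qed (use d p0 in auto)
qed

lemma gauss_map_p0: "gauss_map K p0 = u"
proof -
  obtain d where "d > 0"
    "\<And>p n. p \<in> frontier K \<Longrightarrow> p \<in> ball p0 d \<Longrightarrow> outer_normal K p n \<longleftrightarrow> n = sgn (F p)"
    using outer_normal_near by metis
  then have "outer_normal K p0 n \<longleftrightarrow> n = sgn (F p0)" for n using p0 by simp
  then show ?thesis unfolding gauss_map_def outer_normal_def by (simp add: F_p0 sgn_div_norm norm_u)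
qed

lemma shape_operator_on_tangent:
  assumes v: "u \<bullet> v = 0"
  shows "frechet_derivative (gauss_map K) (at p0 within frontier K) v = F' p0 v - (u \<bullet> F' p0 v) *\<^sub>R u"
proof -
  obtain y and s :: "nat \<Rightarrow> real" where y: "\<And>k. y k \<in> frontier K" "\<And>k. s k > 0" "s \<longlonglongrightarrow> 0"
    "(\<lambda>k. (1 / s k) *\<^sub>R (y k - p0)) \<longlonglongrightarrow> v"
    using tangent_sequence[OF p0, of v] v F_p0 by auto
  have "(gauss_map K has_derivative frechet_derivative (gauss_map K) (at p0 within frontier K)) (at p0 within frontier K)"
    using gauss_map_derivative differentiableI frechet_derivative_works by blast
  from has_derivative_along_tangent_sequence[OF this y]
    has_derivative_along_tangent_sequence[OF gauss_map_derivative y]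
  show ?thesis by (rule LIMSEQ_unique)
qed

text \<open>If strong monotonicity failed near \<open>p0\<close>, then so it would for pairs of points converging to \<open>p0\<close>.
  A limit \<open>w\<close> of their directions is tangent, since \<open>f\<close> vanishes at both points, and satisfies
  \<open>F' p0 w \<bullet> w \<le> 0\<close> by the mean value theorem for the gradient.\<close>

lemma strongly_monotone_normals:
  assumes pos: "\<And>v. v \<noteq> 0 \<Longrightarrow> u \<bullet> v = 0 \<Longrightarrow> F' p0 v \<bullet> v > 0"
  obtains \<kappa> d where "\<kappa> > 0" "d > 0"
    "\<And>p q n m. p \<in> frontier K \<inter> ball p0 d \<Longrightarrow> q \<in> frontier K \<inter> ball p0 d \<Longrightarrow>
      outer_normal K p n \<Longrightarrow> outer_normal K q m \<Longrightarrow>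
      n \<bullet> (p - q) + m \<bullet> (q - p) \<ge> \<kappa> * (norm (p - q))\<^sup>2"
proof (rule ccontr)
  assume contra: "\<not> thesis"
  obtain d where d: "d > 0" "ball p0 d \<subseteq> U"
    "\<And>p n. p \<in> frontier K \<Longrightarrow> p \<in> ball p0 d \<Longrightarrow> outer_normal K p n \<longleftrightarrow> n = sgn (F p)"
    "\<And>p. p \<in> ball p0 d \<Longrightarrow> norm (F p) < 2"
    using outer_normal_near by metis
  define e where "e k = min d (inverse (real (Suc k)))" for k
  have e: "e k > 0" "e k \<le> d" "e k \<le> inverse (real (Suc k))" for k using d by (auto simp: e_def)
  have "\<exists>p q. p \<in> frontier K \<and> p \<in> ball p0 (e k) \<and> q \<in> frontier K \<and> q \<in> ball p0 (e k) \<and>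
      sgn (F p) \<bullet> (p - q) + sgn (F q) \<bullet> (q - p) < inverse (real (Suc k)) * (norm (p - q))\<^sup>2" for k
  proof (rule ccontr)
    assume no: "\<not> ?thesis"
    have "n \<bullet> (p - q) + m \<bullet> (q - p) \<ge> inverse (real (Suc k)) * (norm (p - q))\<^sup>2"
      if "p \<in> frontier K \<inter> ball p0 (e k)" "q \<in> frontier K \<inter> ball p0 (e k)"
        "outer_normal K p n" "outer_normal K q m" for p q n m
    proof -
      have "n = sgn (F p)" "m = sgn (F q)"
        using that d(3)[of p n] d(3)[of q m] e(2)[of k] by auto
      then show ?thesis using no that by force
    qed
    then show False using contra that[of "inverse (real (Suc k))" "e k"] e(1)[of k] by auto
  qed
  then obtain p q where pq: "\<And>k. p k \<in> frontier K" "\<And>k. p k \<in> ball p0 (e k)"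
    "\<And>k. q k \<in> frontier K" "\<And>k. q k \<in> ball p0 (e k)"
    "\<And>k. sgn (F (p k)) \<bullet> (p k - q k) + sgn (F (q k)) \<bullet> (q k - p k) < inverse (real (Suc k)) * (norm (p k - q k))\<^sup>2"
    by metis
  have pqd: "p k \<in> ball p0 d" "q k \<in> ball p0 d" for k using pq(2,4)[of k] e(2)[of k] by auto
  have near: "z \<longlonglongrightarrow> p0" if "\<And>k. z k \<in> ball p0 (e k)" for z
  proof -
    have "norm (z k - p0) \<le> inverse (real (Suc k))" for k
      using that[of k] e(3)[of k] by (simp add: dist_norm norm_minus_commute)
    then have "(\<lambda>k. z k - p0) \<longlonglongrightarrow> 0"
      by (intro Lim_null_comparison[OF _ LIMSEQ_inverse_real_of_nat] always_eventually) auto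
    then show ?thesis by (simp add: LIM_zero_iff)
  qed
  have neq: "p k \<noteq> q k" for k using pq(5)[of k] by auto
  define v where "v k = sgn (p k - q k)" for k
  have nv: "norm (v k) = 1" for k using neq by (simp add: v_def norm_sgn)
  then have "\<forall>k. v k \<in> sphere 0 1" by simp
  then obtain w \<rho> where w: "w \<in> sphere 0 1" "strict_mono \<rho>" "(v \<circ> \<rho>) \<longlonglongrightarrow> w"
    using compact_sphere[of "0::'a" 1] unfolding compact_def by blast
  have seg: "closed_segment (q k) (p k) \<subseteq> ball p0 (e k)" for k
    using pq(2,4) by (simp add: closed_segment_subset)
  have segU: "closed_segment (q k) (p k) \<subseteq> U" for k using seg[of k] e(2)[of k] d(2) by (meson dual_order.trans subset_ball)
  have "\<exists>z. z \<in> ball p0 (e k) \<and> F z \<bullet> v k = 0" for k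
  proof -
    obtain z where z: "z \<in> closed_segment (q k) (p k)" "f (p k) - f (q k) = F z \<bullet> (p k - q k)"
      using f_mean_value[OF segU] by metis
    have "f (p k) = 0" "f (q k) = 0"
      using pq(1,3)[of k] pqd[of k] d(2) in_S_iff by blast+
    then have "F z \<bullet> v k = 0" using z(2) by (simp add: v_def sgn_div_norm)
    then show ?thesis using z(1) seg by blast
  qed
  then obtain z where z: "\<And>k. z k \<in> ball p0 (e k)" "\<And>k. F (z k) \<bullet> v k = 0" by metis
  have sub: "(\<lambda>k. x (\<rho> k)) \<longlonglongrightarrow> p0" if "\<And>k. x k \<in> ball p0 (e k)" for x
    using LIMSEQ_subseq_LIMSEQ[OF near[OF that] w(2)] by (simp add: o_def)
  have vw: "(\<lambda>k. v (\<rho> k)) \<longlonglongrightarrow> w" using w(3) by (simp add: o_def)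
  have "isCont F p0" using F_continuous open_U p0 by (simp add: continuous_on_eq_continuous_at)
  then have "(\<lambda>k. F (z (\<rho> k)) \<bullet> v (\<rho> k)) \<longlonglongrightarrow> F p0 \<bullet> w"
    by (intro tendsto_inner vw isCont_tendsto_compose[OF _ sub[OF z(1)]])
  then have uw: "u \<bullet> w = 0" using z(2) F_p0 by (simp add: LIMSEQ_const_iff)
  have "\<exists>z. z \<in> ball p0 (e k) \<and> F' z (v k) \<bullet> v k \<le> 2 * inverse (real (Suc k))" for k
  proof -
    obtain z where z: "z \<in> closed_segment (q k) (p k)"
      "(F (p k) - F (q k)) \<bullet> (p k - q k) = F' z (p k - q k) \<bullet> (p k - q k)"
      using F_mean_value[OF segU] by metis
    have zU: "z \<in> U" using z segU by blast
    have le: "F x \<bullet> (x - y) \<le> 2 * (sgn (F x) \<bullet> (x - y))"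
      if x: "x \<in> frontier K" "x \<in> ball p0 d" and y: "y \<in> frontier K" for x y
    proof -
      have "sgn (F x) \<bullet> (x - y) \<ge> 0"
        using d(3)[OF x] y frontier_subset by (auto simp: outer_normal_def inner_diff_right)
      then have "norm (F x) * (sgn (F x) \<bullet> (x - y)) \<le> 2 * (sgn (F x) \<bullet> (x - y))"
        using d(4)[OF x(2)] by (intro mult_right_mono) auto
      moreover have "norm (F x) * (sgn (F x) \<bullet> (x - y)) = F x \<bullet> (x - y)"
        by (cases "F x = 0") (simp_all add: sgn_div_norm)
      ultimately show ?thesis by simp
    qed
    have "F' z (p k - q k) \<bullet> (p k - q k) = F (p k) \<bullet> (p k - q k) + F (q k) \<bullet> (q k - p k)"
      unfolding z(2)[symmetric] by (simp add: inner_diff_left inner_diff_right)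
    also have "\<dots> \<le> 2 * (sgn (F (p k)) \<bullet> (p k - q k) + sgn (F (q k)) \<bullet> (q k - p k))"
      using le[OF pq(1) pqd(1) pq(3), of k k] le[OF pq(3) pqd(2) pq(1), of k k] by simp
    also have "\<dots> \<le> 2 * (inverse (real (Suc k)) * (norm (p k - q k))\<^sup>2)"
      using pq(5)[of k] by simp
    finally have *: "F' z (p k - q k) \<bullet> (p k - q k) \<le> 2 * inverse (real (Suc k)) * (norm (p k - q k))\<^sup>2" by simp
    have pv: "p k - q k = norm (p k - q k) *\<^sub>R v k" using neq[of k] by (simp add: v_def sgn_div_norm)
    have "F' z (p k - q k) \<bullet> (p k - q k) = (norm (p k - q k))\<^sup>2 * (F' z (v k) \<bullet> v k)"
      by (subst (1 2) pv) (simp add: linear_cmul[OF linear_F'[OF zU]] power2_eq_square)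
    then have "(norm (p k - q k))\<^sup>2 * (F' z (v k) \<bullet> v k) \<le> (norm (p k - q k))\<^sup>2 * (2 * inverse (real (Suc k)))"
      using * by (simp add: mult.commute)
    then have "F' z (v k) \<bullet> v k \<le> 2 * inverse (real (Suc k))"
      using neq[of k] by (subst (asm) mult_le_cancel_left_pos) auto
    then show ?thesis using z(1) seg by blast
  qed
  then obtain z' where z': "\<And>k. z' k \<in> ball p0 (e k)"
    "\<And>k. F' (z' k) (v k) \<bullet> v k \<le> 2 * inverse (real (Suc k))" by metis
  have "(\<lambda>k. F' (z' (\<rho> k)) (v (\<rho> k)) \<bullet> v (\<rho> k)) \<longlonglongrightarrow> F' p0 w \<bullet> w"
    by (intro tendsto_inner vw F'_tendsto p0 sub z')
  moreover have "(\<lambda>k. 2 * inverse (real (Suc (\<rho> k)))) \<longlonglongrightarrow> 2 * 0"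
    using LIMSEQ_subseq_LIMSEQ[OF LIMSEQ_inverse_real_of_nat w(2)]
    by (intro tendsto_mult tendsto_const) (simp add: o_def)
  ultimately have "F' p0 w \<bullet> w \<le> 2 * 0"
    by (rule LIMSEQ_le) (use z'(2) in blast)
  moreover have "F' p0 w \<bullet> w > 0" using w(1) uw by (intro pos) auto
  ultimately show False by simp
qed

text \<open>A null vector of a positive semidefinite symmetric form is in its kernel; here the form lives on
  the orthogonal complement of \<open>u\<close>.\<close>

lemma F'_null_direction:
  assumes v: "u \<bullet> v = 0" and null: "F' p0 v \<bullet> v = 0"
  shows "F' p0 v = (u \<bullet> F' p0 v) *\<^sub>R u"
proof -
  have lin: "linear (F' p0)" using linear_F' p0 by blast
  have zero: "F' p0 v \<bullet> w = 0" if w: "u \<bullet> w = 0" for w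
  proof -
    define b where "b = F' p0 v \<bullet> w"
    define c where "c = F' p0 w \<bullet> w"
    have c: "c \<ge> 0" using F'_positive_semidefinite[OF w] by (simp add: c_def)
    \<comment> \<open>The form at \<open>v + t w\<close> is \<open>2 t b + t\<^sup>2 c\<close>; any small \<open>t\<close> of sign opposite to \<open>b\<close> makes it negative.\<close>
    define t where "t = - b / (c + 1)"
    have "0 \<le> F' p0 (v + t *\<^sub>R w) \<bullet> (v + t *\<^sub>R w)"
      using v w by (intro F'_positive_semidefinite) (simp add: inner_add_right)
    also have "\<dots> = 2 * t * b + t\<^sup>2 * c"
      using F'_symmetric[OF p0(2), of w v] null
      by (simp add: b_def c_def linear_add[OF lin] linear_cmul[OF lin] inner_add_left inner_add_right
          power2_eq_square algebra_simps)
    finally have "0 \<le> (2 * t * b + t\<^sup>2 * c) * (c + 1)\<^sup>2" by simp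
    also have "\<dots> = 2 * (t * (c + 1)) * b * (c + 1) + (t * (c + 1))\<^sup>2 * c"
      by (simp add: power2_eq_square algebra_simps)
    also have "t * (c + 1) = - b" using c by (simp add: t_def)
    finally have "b\<^sup>2 * (c + 2) \<le> 0" by (simp add: power2_eq_square algebra_simps)
    then have "b = 0" using c by (simp add: mult_le_0_iff)
    then show ?thesis by (simp add: b_def)
  qed
  define z where "z = F' p0 v - (u \<bullet> F' p0 v) *\<^sub>R u"
  have uz: "u \<bullet> z = 0" using norm_u by (simp add: z_def inner_diff_right norm_eq_1)
  have "z \<bullet> z = F' p0 v \<bullet> z" using uz by (simp add: z_def inner_diff_left)
  then have "z = 0" using zero[OF uz] by simp
  then show ?thesis by (simp add: z_def)
qed

end

text \<open>A tangent null vector would be in the kernel of the shape operator, whose determinant is the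
  curvature.\<close>

lemma F'_positive_definite:
  fixes K :: "(real ^ 'n) set"
  assumes chart: "convex_chart K U f F F' p0 u" and curv: "gaussian_curvature K p0 \<noteq> 0"
    and v: "v \<noteq> 0" "u \<bullet> v = 0"
  shows "F' p0 v \<bullet> v > 0"
proof (rule ccontr)
  assume neg: "\<not> F' p0 v \<bullet> v > 0"
  interpret convex_chart K U f F F' p0 u by (rule chart)
  have null: "F' p0 v \<bullet> v = 0" using neg F'_positive_semidefinite[OF v(2)] by simp
  define D where "D = frechet_derivative (gauss_map K) (at p0 within frontier K)"
  define M where "M = (\<lambda>v. D (v - (v \<bullet> u) *\<^sub>R u) + (v \<bullet> u) *\<^sub>R u)"
  have "(gauss_map K has_derivative D) (at p0 within frontier K)"
    unfolding D_def using gauss_map_derivative differentiableI frechet_derivative_works by blast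
  then have lin: "linear D" using has_derivative_linear by blast
  have linM: "linear M"
    by (rule linearI) (simp_all add: M_def linear_add[OF lin] linear_diff[OF lin] linear_cmul[OF lin]
        inner_add_left algebra_simps)
  have "det (matrix M) \<noteq> 0"
    using curv by (simp add: gaussian_curvature_def Let_def gauss_map_p0 M_def D_def)
  then have "inj M" using det_nz_iff_inj[OF linM] by simp
  moreover have "M v = 0"
    using shape_operator_on_tangent[OF v(2)] F'_null_direction[OF v(2) null] v
    by (simp add: M_def D_def inner_commute)
  moreover have "M 0 = 0" using linear_0[OF linM] .
  ultimately show False using v(1) by (metis injD)
qed

lemma strongly_monotone_normals_at_curved_point:
  fixes K :: "(real ^ 'n) set"
  assumes K: "Ck_convex_body 3 K" and p0: "p0 \<in> frontier K" and curv: "gaussian_curvature K p0 \<noteq> 0"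
    and u: "outer_normal K p0 u"
  obtains \<kappa> d where "\<kappa> > 0" "d > 0"
    "\<And>p q n m. p \<in> frontier K \<inter> ball p0 d \<Longrightarrow> q \<in> frontier K \<inter> ball p0 d \<Longrightarrow>
      outer_normal K p n \<Longrightarrow> outer_normal K q m \<Longrightarrow>
      n \<bullet> (p - q) + m \<bullet> (q - p) \<ge> \<kappa> * (norm (p - q))\<^sup>2"
proof -
  have K': "convex K" "compact K" "closed K" "interior K \<noteq> {}" "Ck_hypersurface 3 (frontier K)"
    using K by (auto simp: Ck_convex_body_def convex_body_def compact_imp_closed)
  obtain U f F F' where C: "C2_chart (frontier K) U f F F'" and U: "p0 \<in> U"
    using C2_chart_exists[OF K'(5) p0] by metis
  interpret C0: C2_chart "frontier K" U f F F' by (rule C)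
  have fs: "frontier K \<subseteq> K" using K' by (simp add: frontier_subset_closed)
  obtain a where a: "u = a *\<^sub>R F p0"
    using C0.normal_parallel_gradient[OF p0 U, of u] u fs by (auto simp: outer_normal_def)
  have "a \<noteq> 0" using a u by (auto simp: outer_normal_def)
  then interpret C1: C2_chart "frontier K" U "\<lambda>x. a * f x" "\<lambda>x. a *\<^sub>R F x" "\<lambda>x v. a *\<^sub>R F' x v"
    using C2_chart_scale[OF C] by blast
  interpret convex_chart K U "\<lambda>x. a * f x" "\<lambda>x. a *\<^sub>R F x" "\<lambda>x v. a *\<^sub>R F' x v" p0 u
    using K' p0 U u a by unfold_locales auto
  have "convex_chart K U (\<lambda>x. a * f x) (\<lambda>x. a *\<^sub>R F x) (\<lambda>x v. a *\<^sub>R F' x v) p0 u"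
    by unfold_locales
  from strongly_monotone_normals[OF F'_positive_definite[OF this curv]] show ?thesis
    using that by blast
qed

section \<open>Local maxima of the stretched distance\<close>

text \<open>Up to the factor \<open>t\<^sup>2 - 1\<close> this is the squared distance from \<open>c\<close> after stretching by \<open>t\<close> in the
  direction \<open>u\<close>, where \<open>e = 1 / (t\<^sup>2 - 1)\<close>.\<close>

definition height_form :: "'a::euclidean_space \<Rightarrow> 'a \<Rightarrow> real \<Rightarrow> 'a \<Rightarrow> real" where
  "height_form c u e x = (u \<bullet> (x - c))\<^sup>2 + e * (norm (x - c))\<^sup>2"

text \<open>Half the gradient of \<open>height_form\<close>.\<close>

definition height_grad :: "'a::euclidean_space \<Rightarrow> 'a \<Rightarrow> real \<Rightarrow> 'a \<Rightarrow> 'a" where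
  "height_grad c u e x = (u \<bullet> (x - c)) *\<^sub>R u + e *\<^sub>R (x - c)"

definition local_max_points :: "('a::metric_space \<Rightarrow> real) \<Rightarrow> 'a set \<Rightarrow> 'a set" where
  "local_max_points g S = {p \<in> S. \<exists>e>0. \<forall>q\<in>S \<inter> ball p e. g q \<le> g p}"

lemma height_form_minus [simp]: "height_form c (- u) e = height_form c u e"
  by (simp add: height_form_def fun_eq_iff)

lemma height_form_expansion:
  "height_form c u e y = height_form c u e p + 2 * (height_grad c u e p \<bullet> (y - p))
    + (u \<bullet> (y - p))\<^sup>2 + e * (norm (y - p))\<^sup>2"
proof -
  have 1: "u \<bullet> (y - c) = u \<bullet> (p - c) + u \<bullet> (y - p)" by (simp add: inner_diff_right)
  have "y - c = 1 *\<^sub>R (p - c) + 1 *\<^sub>R (y - p)" by simp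
  then have 2: "(norm (y - c))\<^sup>2 = (norm (p - c))\<^sup>2 + 2 * ((p - c) \<bullet> (y - p)) + (norm (y - p))\<^sup>2"
    using norm_scaleR_add_power2[of 1 "p - c" 1 "y - p"] by (simp only:) (simp add: inner_commute)
  have 3: "height_grad c u e p \<bullet> (y - p) = (u \<bullet> (p - c)) * (u \<bullet> (y - p)) + e * ((p - c) \<bullet> (y - p))"
    by (simp add: height_grad_def inner_add_left)
  show ?thesis
    unfolding height_form_def 1 2 3 by (simp add: power2_eq_square algebra_simps)
qed

lemma height_form_radial:
  assumes "\<tau> \<ge> 1" "e \<ge> 0"
  shows "height_form c u e x \<le> height_form c u e (c + \<tau> *\<^sub>R (x - c))"
proof -
  have "height_form c u e (c + \<tau> *\<^sub>R (x - c)) = \<tau>\<^sup>2 * height_form c u e x"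
    by (simp add: height_form_def power_mult_distrib inner_scaleR_right distrib_left
        del: inner_diff_right)
  moreover have "height_form c u e x \<ge> 0" using assms by (simp add: height_form_def)
  moreover have "\<tau>\<^sup>2 \<ge> 1" using assms by simp
  ultimately show ?thesis by (simp add: mult_le_cancel_right1)
qed

lemma small_step_in_convex:
  fixes K :: "'a::real_normed_vector set"
  assumes K: "convex K" "p \<in> K" "y \<in> K" and d: "d > 0"
  obtains s where "0 < s" "s \<le> 1" "p + s *\<^sub>R (y - p) \<in> K \<inter> ball p d"
proof -
  define s where "s = min 1 (d / (2 * (norm (y - p) + 1)))"
  have N: "norm (y - p) + 1 > 0" by (simp add: add_nonneg_pos)
  have s: "0 < s" "s \<le> 1" using d N by (auto simp: s_def)
  have "s * norm (y - p) \<le> s * (norm (y - p) + 1)" using s by simp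
  also have "\<dots> \<le> d / 2"
  proof -
    have "s \<le> (d / 2) / (norm (y - p) + 1)" by (simp add: s_def)
    then show ?thesis using N by (simp only: pos_le_divide_eq)
  qed
  finally have "p + s *\<^sub>R (y - p) \<in> ball p d" using d s by (simp add: dist_norm)
  moreover have "p + s *\<^sub>R (y - p) \<in> K"
    using convexD_alt[OF K, of s] s by (simp add: algebra_simps)
  ultimately show ?thesis using that s by blast
qed

lemma compact_diameter_bound:
  fixes K :: "'a::real_normed_vector set"
  assumes "compact K"
  obtains D where "D > 0" "\<And>x y. x \<in> K \<Longrightarrow> y \<in> K \<Longrightarrow> norm (x - y) \<le> D"
proof -
  obtain B where B: "\<And>x y. x \<in> K \<Longrightarrow> y \<in> K \<Longrightarrow> dist x y \<le> B"
    using compact_imp_bounded[OF assms] by (auto simp: bounded_two_points)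
  show ?thesis by (rule that[of "\<bar>B\<bar> + 1"]) (use B in \<open>force simp: dist_norm\<close>)+
qed

text \<open>A point \<open>x\<close> of \<open>K\<close> near \<open>p\<close> is pushed along the ray from \<open>c\<close> to the boundary, which does not
  decrease \<open>g\<close>. It ends near \<open>p\<close>: the boundary point \<open>p\<close> moved outwards by the factor \<open>1 + \<eta>\<close> is
  outside the closed set \<open>K\<close>, and hence so are the points \<open>x\<close> close to \<open>p\<close> moved in the same way.\<close>

lemma local_max_on_body:
  fixes K :: "'a::euclidean_space set"
  assumes K: "convex K" "compact K" and c: "c \<in> interior K"
    and radial: "\<And>\<tau> x. \<tau> \<ge> 1 \<Longrightarrow> g x \<le> g (c + \<tau> *\<^sub>R (x - c))"
    and p: "p \<in> local_max_points g (frontier K)"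
  shows "p \<in> local_max_points g K"
proof -
  have pf: "p \<in> frontier K" using p by (simp add: local_max_points_def)
  obtain e where e: "e > 0" "\<And>q. q \<in> frontier K \<Longrightarrow> q \<in> ball p e \<Longrightarrow> g q \<le> g p"
    using p by (auto simp: local_max_points_def)
  have cl: "closed K" using K by (simp add: compact_imp_closed)
  have pK: "p \<in> K" using pf cl by (simp add: frontier_def)
  have p_int: "p \<notin> interior K" using pf by (simp add: frontier_def)
  have pc: "p \<noteq> c" using p_int c by blast
  define R where "R = norm (p - c)"
  have R: "R > 0" using pc by (simp add: R_def)
  define \<eta> where "\<eta> = e / (8 * R)"
  have \<eta>: "\<eta> > 0" using e R by (simp add: \<eta>_def)
  define p' where "p' = c + (1 + \<eta>) *\<^sub>R (p - c)"
  have "p' \<notin> K"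
  proof
    assume "p' \<in> K"
    then have "p' \<in> closure K" using closure_subset by blast
    moreover have "p \<in> open_segment c p'"
    proof -
      have "p = (1 - 1 / (1 + \<eta>)) *\<^sub>R c + (1 / (1 + \<eta>)) *\<^sub>R p'"
        using \<eta> by (simp add: p'_def algebra_simps add_divide_distrib[symmetric] flip: scaleR_add_left)
      moreover have "0 < 1 / (1 + \<eta>)" "1 / (1 + \<eta>) < 1" using \<eta> by auto
      moreover have "c \<noteq> p'" using \<eta> pc by (simp add: p'_def)
      ultimately show ?thesis unfolding in_segment by blast
    qed
    ultimately show False using in_interior_closure_convex_segment[OF K(1) c] p_int by blast
  qed
  then obtain \<rho> where \<rho>: "\<rho> > 0" "ball p' \<rho> \<subseteq> - K"
    using cl by (metis ComplI open_Compl open_contains_ball)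
  define d where "d = min (\<rho> / (1 + \<eta>)) (min (e / 2) R)"
  have d: "d > 0" "d \<le> e / 2" "d \<le> R" "(1 + \<eta>) * d \<le> \<rho>"
  proof -
    show "d > 0" using \<rho> \<eta> e R by (auto simp: d_def)
    show "d \<le> e / 2" "d \<le> R" unfolding d_def by (meson min.cobounded1 min.cobounded2 order_trans)+
    have "d \<le> \<rho> / (1 + \<eta>)" by (simp add: d_def)
    then show "(1 + \<eta>) * d \<le> \<rho>" using \<eta> by (simp add: pos_le_divide_eq mult.commute)
  qed
  have "g x \<le> g p" if x: "x \<in> K" "x \<in> ball p d" for x
  proof -
    have xp: "norm (x - p) < d" using x by (simp add: dist_norm norm_minus_commute)
    have xc: "x - c \<noteq> 0" using xp d by (auto simp: R_def norm_minus_commute)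
    obtain \<tau> where \<tau>: "0 < \<tau>" "c + \<tau> *\<^sub>R (x - c) \<in> frontier K"
      "\<And>s. 0 \<le> s \<Longrightarrow> s < \<tau> \<Longrightarrow> c + s *\<^sub>R (x - c) \<in> interior K"
      using ray_to_frontier[OF compact_imp_bounded[OF K(2)] c xc] by metis
    have "\<tau> \<ge> 1"
    proof (rule ccontr)
      assume "\<not> \<tau> \<ge> 1"
      then have "c + \<tau> *\<^sub>R (x - c) \<in> open_segment c x"
        using \<tau>(1) xc unfolding in_segment by (intro conjI exI[of _ \<tau>]) (auto simp: algebra_simps)
      then have "c + \<tau> *\<^sub>R (x - c) \<in> interior K"
        using in_interior_closure_convex_segment[OF K(1) c] x(1) closure_subset by blast
      then show False using \<tau>(2) by (simp add: frontier_def)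
    qed
    have "\<tau> \<le> 1 + \<eta>"
    proof (rule ccontr)
      assume "\<not> \<tau> \<le> 1 + \<eta>"
      then have "c + (1 + \<eta>) *\<^sub>R (x - c) \<in> K"
        using \<tau>(3)[of "1 + \<eta>"] \<eta> interior_subset by auto
      moreover have "c + (1 + \<eta>) *\<^sub>R (x - c) \<in> ball p' \<rho>"
      proof -
        have "p' - (c + (1 + \<eta>) *\<^sub>R (x - c)) = (1 + \<eta>) *\<^sub>R (p - x)"
          by (simp add: p'_def scaleR_diff_right)
        then have "dist p' (c + (1 + \<eta>) *\<^sub>R (x - c)) = (1 + \<eta>) * norm (x - p)"
          using \<eta> by (simp add: dist_norm norm_minus_commute)
        also have "\<dots> < (1 + \<eta>) * d" using xp \<eta> by simp
        finally show ?thesis using d by simp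
      qed
      ultimately show False using \<rho> by blast
    qed
    have "norm (c + \<tau> *\<^sub>R (x - c) - p) \<le> norm (x - p) + norm ((\<tau> - 1) *\<^sub>R (x - c))"
      using norm_triangle_ineq[of "x - p" "(\<tau> - 1) *\<^sub>R (x - c)"] by (simp add: algebra_simps)
    also have "norm ((\<tau> - 1) *\<^sub>R (x - c)) \<le> \<eta> * (2 * R)"
    proof -
      have "norm (x - c) \<le> norm (x - p) + R"
        unfolding R_def using norm_triangle_ineq[of "x - p" "p - c"] by simp
      then have "norm (x - c) \<le> 2 * R" using xp d by simp
      then show ?thesis using \<open>\<tau> \<ge> 1\<close> \<open>\<tau> \<le> 1 + \<eta>\<close> \<eta> by (auto intro!: mult_mono)
    qed
    also have "\<eta> * (2 * R) = e / 4" using R by (simp add: \<eta>_def)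
    finally have "c + \<tau> *\<^sub>R (x - c) \<in> ball p e" using xp d e(1) by (simp add: dist_norm norm_minus_commute)
    then have "g (c + \<tau> *\<^sub>R (x - c)) \<le> g p" using e \<tau> by blast
    then show ?thesis using radial[OF \<open>\<tau> \<ge> 1\<close>, of x] by simp
  qed
  then show ?thesis using pK d by (auto simp: local_max_points_def)
qed

lemma local_max_first_order:
  assumes K: "convex K" and p: "p \<in> local_max_points (height_form c u e) K" and e: "e \<ge> 0"
    and y: "y \<in> K"
  shows "height_grad c u e p \<bullet> (y - p) \<le> 0"
proof (rule ccontr)
  assume "\<not> ?thesis"
  then have pos: "height_grad c u e p \<bullet> (y - p) > 0" by simp
  obtain d where d: "d > 0" "p \<in> K" "\<And>q. q \<in> K \<Longrightarrow> q \<in> ball p d \<Longrightarrow> height_form c u e q \<le> height_form c u e p"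
    using p by (auto simp: local_max_points_def)
  obtain s where s: "0 < s" "s \<le> 1" "p + s *\<^sub>R (y - p) \<in> K \<inter> ball p d"
    using small_step_in_convex[OF K d(2) y d(1)] by metis
  then have "height_form c u e (p + s *\<^sub>R (y - p)) \<le> height_form c u e p" using d by blast
  then have "2 * (s * (height_grad c u e p \<bullet> (y - p))) + (s * (u \<bullet> (y - p)))\<^sup>2 + e * (s * norm (y - p))\<^sup>2 \<le> 0"
    unfolding height_form_expansion[of c u e "p + s *\<^sub>R (y - p)" p] using s by simp
  moreover have "s * (height_grad c u e p \<bullet> (y - p)) > 0" using pos s by simp
  moreover have "e * (s * norm (y - p))\<^sup>2 \<ge> 0" using e by simp
  ultimately show False using zero_le_power2[of "s * (u \<bullet> (y - p))"] by linarith
qed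

lemma height_grad_nonzero:
  assumes "e > 0" "x \<noteq> c"
  shows "height_grad c u e x \<noteq> 0"
proof
  assume "height_grad c u e x = 0"
  then have "height_grad c u e x \<bullet> (x - c) = 0" by simp
  then have "(u \<bullet> (x - c))\<^sup>2 + e * (norm (x - c))\<^sup>2 = 0"
    by (simp add: height_grad_def inner_add_left dot_square_norm power2_eq_square[of "u \<bullet> (x - c)"])
  moreover have "e * (norm (x - c))\<^sup>2 > 0" using assms by simp
  ultimately show False using zero_le_power2[of "u \<bullet> (x - c)"] by linarith
qed

lemma outer_normal_at_local_max:
  assumes K: "convex K" and p: "p \<in> local_max_points (height_form c u e) K" and e: "e > 0" "p \<noteq> c"
  shows "outer_normal K p (sgn (height_grad c u e p))"
proof -
  let ?g = "height_grad c u e p"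
  have "?g \<bullet> y \<le> ?g \<bullet> p" if "y \<in> K" for y
    using local_max_first_order[OF K p _ that] e by (simp add: inner_diff_right)
  then have "sgn ?g \<bullet> y \<le> sgn ?g \<bullet> p" if "y \<in> K" for y
    using that by (simp add: sgn_div_norm divide_right_mono mult_left_mono)
  then show ?thesis using height_grad_nonzero[OF e] by (simp add: outer_normal_def norm_sgn)
qed

text \<open>The gradient must be normal to the ball, so the ball is tangent to the level set of
  \<open>height_form\<close> at \<open>p\<close>. Moving along the ball in the direction of the tangential part \<open>w\<close> of \<open>u\<close>
  by \<open>s\<close> loses at most \<open>2 * norm g * s\<^sup>2 / r\<close> to first order in the displacement and gains
  about \<open>s\<^sup>2 * (u \<bullet> w)\<^sup>2 = s\<^sup>2 * norm w ^ 4\<close>. At a maximum the gain cannot exceed the loss.\<close>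

lemma local_max_touching_ball_bound:
  assumes K: "convex K" and p: "p \<in> local_max_points (height_form c u e) K" and e: "e > 0"
    and n: "norm n = 1" and r: "r > 0" "cball (p - r *\<^sub>R n) r \<subseteq> K" and u: "norm u = 1"
  shows "(norm (u - (u \<bullet> n) *\<^sub>R n)) ^ 4 \<le> 2 * norm (height_grad c u e p) / r"
    and "height_grad c u e p = norm (height_grad c u e p) *\<^sub>R n"
proof -
  define g where "g = height_grad c u e p"
  define w where "w = u - (u \<bullet> n) *\<^sub>R n"
  have first: "g \<bullet> (y - p) \<le> 0" if "y \<in> K" for y
    using local_max_first_order[OF K p _ that] e by (simp add: g_def)
  have gn: "g = norm g *\<^sub>R n"
  proof (cases "g = 0")
    case False
    have "p - r *\<^sub>R n + r *\<^sub>R sgn g \<in> K"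
      using r False by (intro subsetD[OF r(2)]) (simp add: dist_norm norm_sgn)
    from first[OF this] have "r * (g \<bullet> sgn g) \<le> r * (g \<bullet> n)"
      by (simp add: inner_add_right inner_diff_right)
    then have "g \<bullet> sgn g \<le> g \<bullet> n" using r by simp
    moreover have "g \<bullet> sgn g = norm g"
      using False by (simp add: sgn_div_norm dot_square_norm power2_eq_square)
    ultimately have "norm g * norm n \<le> g \<bullet> n" using n by simp
    then have "g \<bullet> n = norm g * norm n" using norm_cauchy_schwarz[of g n] by linarith
    then have "norm g *\<^sub>R n = norm n *\<^sub>R g" by (rule norm_cauchy_schwarz_eq[THEN iffD1])
    then show ?thesis using n by simp
  qed simp
  then show "height_grad c u e p = norm (height_grad c u e p) *\<^sub>R n" by (simp add: g_def)
  have nn: "n \<bullet> n = 1" using n by (simp add: norm_eq_1)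
  have nw: "n \<bullet> w = 0" using nn by (simp add: w_def inner_diff_right inner_commute)
  have uw: "u \<bullet> w = (norm w)\<^sup>2"
  proof -
    have "u = w + (u \<bullet> n) *\<^sub>R n" by (simp add: w_def)
    then have "u \<bullet> w = (w + (u \<bullet> n) *\<^sub>R n) \<bullet> w" by simp
    then show ?thesis using nw by (simp add: inner_add_left power2_norm_eq_inner)
  qed
  have w1: "(norm w)\<^sup>2 \<le> 1"
  proof -
    have "(norm w)\<^sup>2 \<le> norm u * norm w" unfolding uw[symmetric] by (rule norm_cauchy_schwarz)
    then have "norm w \<le> 1" using u by (cases "norm w = 0") (auto simp: power2_eq_square)
    then show ?thesis by (simp add: power_le_one)
  qed
  obtain d where d: "d > 0" "\<And>q. q \<in> K \<Longrightarrow> q \<in> ball p d \<Longrightarrow> height_form c u e q \<le> height_form c u e p"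
    using p by (auto simp: local_max_points_def)
  have bound: "((norm w)\<^sup>2 - s * (u \<bullet> n) / r)\<^sup>2 \<le> 2 * norm g / r" if s: "0 < s" "s \<le> r" "2 * s < d" for s
  proof -
    \<comment> \<open>The term of order \<open>s\<^sup>2\<close> is at least twice what the curvature of the ball requires, which keeps \<open>y\<close> inside
      for \<open>s \<le> r\<close>.\<close>
    define y where "y = p + (s *\<^sub>R w - (s\<^sup>2 / r) *\<^sub>R n)"
    have "(norm (s *\<^sub>R w + (r - s\<^sup>2 / r) *\<^sub>R n))\<^sup>2 = s\<^sup>2 * (norm w)\<^sup>2 + (r - s\<^sup>2 / r)\<^sup>2"
      using norm_scaleR_add_power2[of s w "r - s\<^sup>2 / r" n] nw n by simp
    also have "\<dots> \<le> s\<^sup>2 * 1 + (r - s\<^sup>2 / r)\<^sup>2"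
      using w1 by (intro add_right_mono mult_left_mono) auto
    also have "\<dots> = r\<^sup>2 + (s\<^sup>2 / r) * (s\<^sup>2 / r - r)"
      using r by (simp add: power2_diff) (simp add: power2_eq_square field_simps)
    also have "\<dots> \<le> r\<^sup>2"
    proof -
      have "s\<^sup>2 \<le> r\<^sup>2" using s by (intro power_mono) auto
      then have "s\<^sup>2 / r \<le> r" using r by (simp add: pos_divide_le_eq power2_eq_square)
      then have "(s\<^sup>2 / r) * (s\<^sup>2 / r - r) \<le> 0" using r by (intro mult_nonneg_nonpos) auto
      then show ?thesis by linarith
    qed
    finally have "norm (s *\<^sub>R w + (r - s\<^sup>2 / r) *\<^sub>R n) \<le> r"
      by (rule power2_le_imp_le) (use r in simp)
    moreover have "y - (p - r *\<^sub>R n) = s *\<^sub>R w + (r - s\<^sup>2 / r) *\<^sub>R n"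
      by (simp add: y_def algebra_simps)
    ultimately have "y \<in> K"
      by (intro subsetD[OF r(2)]) (metis dist_commute dist_norm mem_cball)
    moreover have "y \<in> ball p d"
    proof -
      have "norm (s *\<^sub>R w - (s\<^sup>2 / r) *\<^sub>R n) \<le> s * norm w + s\<^sup>2 / r"
        using norm_triangle_ineq4[of "s *\<^sub>R w" "(s\<^sup>2 / r) *\<^sub>R n"] n s r by simp
      also have "s * norm w \<le> s" using w1 s by (simp add: power_le_one_iff mult_left_le)
      also have "s\<^sup>2 / r \<le> s" using s r by (simp add: pos_divide_le_eq power2_eq_square)
      finally show ?thesis
        using s norm_minus_commute[of "s *\<^sub>R w" "(s\<^sup>2 / r) *\<^sub>R n"] by (simp add: y_def dist_norm)
    qed
    ultimately have "height_form c u e y \<le> height_form c u e p" by (rule d(2))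
    then have "2 * (g \<bullet> (y - p)) + (u \<bullet> (y - p))\<^sup>2 + e * (norm (y - p))\<^sup>2 \<le> 0"
      unfolding height_form_expansion[of c u e y p] g_def[symmetric] by simp
    moreover have "g \<bullet> (y - p) = - (norm g * (s\<^sup>2 / r))"
      by (subst gn) (simp add: y_def inner_diff_right nw nn)
    moreover have "u \<bullet> (y - p) = s * ((norm w)\<^sup>2 - s * (u \<bullet> n) / r)"
      by (simp add: y_def inner_diff_right uw power2_eq_square algebra_simps)
    moreover have "e * (norm (y - p))\<^sup>2 \<ge> 0" using e by simp
    ultimately have "(s * ((norm w)\<^sup>2 - s * (u \<bullet> n) / r))\<^sup>2 \<le> 2 * (norm g * (s\<^sup>2 / r))"
      by (smt (verit))
    also have "\<dots> = s\<^sup>2 * (2 * norm g / r)" by simp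
    finally have "s\<^sup>2 * ((norm w)\<^sup>2 - s * (u \<bullet> n) / r)\<^sup>2 \<le> s\<^sup>2 * (2 * norm g / r)"
      unfolding power_mult_distrib .
    then show ?thesis by (rule mult_left_le_imp_le) (use s in simp)
  qed
  have "((\<lambda>s. ((norm w)\<^sup>2 - s * (u \<bullet> n) / r)\<^sup>2) \<longlongrightarrow> ((norm w)\<^sup>2 - 0 * (u \<bullet> n) / r)\<^sup>2) (at_right 0)"
    using r by (intro tendsto_intros) auto
  moreover have "\<forall>\<^sub>F s in at_right 0. ((norm w)\<^sup>2 - s * (u \<bullet> n) / r)\<^sup>2 \<le> 2 * norm g / r"
  proof -
    have "min r (d / 4) > 0" using r d by simp
    then have "\<forall>\<^sub>F s in at_right 0. 0 < s \<and> s < min r (d / 4)"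
      unfolding eventually_at_right_field by blast
    then show ?thesis by eventually_elim (use d in \<open>auto intro!: bound\<close>)
  qed
  ultimately have "((norm w)\<^sup>2 - 0 * (u \<bullet> n) / r)\<^sup>2 \<le> 2 * norm g / r"
    by (rule tendsto_upperbound) simp
  then show "(norm (u - (u \<bullet> n) *\<^sub>R n)) ^ 4 \<le> 2 * norm (height_grad c u e p) / r"
    by (simp add: w_def g_def flip: power_mult)
qed


text \<open>The gradient is small here, so by \<open>local_max_touching_ball_bound\<close> \<open>u\<close> would have to be almost normal to \<open>K\<close>. But
  \<open>K\<close> contains \<open>c \<plusminus> \<rho> u\<close>, which lie at height \<open>\<plusminus> \<rho>\<close>, so that neither \<open>u\<close> nor \<open>- u\<close> is close to
  an outer normal at a point of height close to \<open>0\<close>.\<close>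

lemma no_local_max_near_equator:
  fixes K :: "'a::euclidean_space set"
  assumes K: "Ck_convex_body 3 K" and c: "c \<in> interior K" and u: "norm u = 1"
    and p0: "p0 \<in> frontier K" "u \<bullet> (p0 - c) = 0"
  obtains d e0 where "d > 0" "e0 > 0"
    "\<And>e p. 0 < e \<Longrightarrow> e < e0 \<Longrightarrow> p \<in> ball p0 d \<Longrightarrow> p \<notin> local_max_points (height_form c u e) (frontier K)"
proof -
  have K': "convex K" "compact K" "closed K"
    using K by (auto simp: Ck_convex_body_def convex_body_def compact_imp_closed)
  have fs: "frontier K \<subseteq> K" using K' by (simp add: frontier_subset_closed)
  obtain r d1 where r: "r > 0" "d1 > 0"
    "\<And>p. p \<in> frontier K \<Longrightarrow> p \<in> ball p0 d1 \<Longrightarrow> \<exists>n. norm n = 1 \<and> cball (p - r *\<^sub>R n) r \<subseteq> K"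
    using locally_uniform_interior_ball[OF K p0(1)] by metis
  obtain \<rho> where \<rho>: "\<rho> > 0" "cball c \<rho> \<subseteq> K" using c by (auto simp: mem_interior_cball)
  obtain D where D: "D > 0" "\<And>x y. x \<in> K \<Longrightarrow> y \<in> K \<Longrightarrow> norm (x - y) \<le> D"
    using compact_diameter_bound[OF K'(2)] by metis
  define \<omega> where "\<omega> = \<rho> / (2 * D)"
  have \<omega>: "\<omega> > 0" using \<rho> D by (simp add: \<omega>_def)
  define d where "d = min d1 (min (\<rho> / 2) (r * \<omega> ^ 4 / 8))"
  define e0 where "e0 = r * \<omega> ^ 4 / (8 * D)"
  have d: "d > 0" "d \<le> d1" "d \<le> \<rho> / 2" "d \<le> r * \<omega> ^ 4 / 8"
    unfolding d_def using r \<rho> \<omega> by (simp, meson min.cobounded1 min.cobounded2 order_trans)+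
  have e0: "e0 > 0" "e0 * D = r * \<omega> ^ 4 / 8" using r D \<omega> by (simp_all add: e0_def)
  have "p \<notin> local_max_points (height_form c u e) (frontier K)"
    if e: "0 < e" "e < e0" and p: "p \<in> ball p0 d" for e p
  proof
    assume L: "p \<in> local_max_points (height_form c u e) (frontier K)"
    then have pf: "p \<in> frontier K" by (simp add: local_max_points_def)
    have L': "p \<in> local_max_points (height_form c u e) K"
      using e by (intro local_max_on_body[OF K'(1,2) c _ L] height_form_radial) auto
    obtain n where n: "norm n = 1" "cball (p - r *\<^sub>R n) r \<subseteq> K"
      using r(3)[OF pf] p d(2) by auto
    define g where "g = height_grad c u e p"
    define w where "w = u - (u \<bullet> n) *\<^sub>R n"
    have B: "norm w ^ 4 \<le> 2 * norm g / r" and gn: "g = norm g *\<^sub>R n"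
      using local_max_touching_ball_bound[OF K'(1) L' e(1) n(1) r(1) n(2) u] by (simp_all add: g_def w_def)
    have pc: "p \<noteq> c" using pf c by (auto simp: frontier_def)
    have "g \<noteq> 0" using height_grad_nonzero[OF e(1) pc] by (simp add: g_def)
    then have "sgn g = n" by (subst gn) (simp add: sgn_scaleR sgn_div_norm n)
    then have nrm: "n \<bullet> y \<le> n \<bullet> p" if "y \<in> K" for y
      using outer_normal_at_local_max[OF K'(1) L' e(1) pc] that by (simp add: g_def outer_normal_def)
    define h where "h = u \<bullet> (p - c)"
    have "h = u \<bullet> (p - p0)" using p0(2) by (simp add: h_def inner_diff_right)
    then have hd: "\<bar>h\<bar> \<le> d"
      using Cauchy_Schwarz_ineq2[of u "p - p0"] u p by (simp add: dist_norm norm_minus_commute)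
    have pK: "p \<in> K" using pf fs by blast
    have cK: "c \<in> K" using c interior_subset by blast
    have wbound: "\<omega> \<le> norm w"
    proof -
      have split: "u \<bullet> (y - p) = (u \<bullet> n) * (n \<bullet> (y - p)) + w \<bullet> (y - p)" for y
        by (simp add: w_def inner_diff_left)
      have wD: "\<bar>w \<bullet> (y - p)\<bar> \<le> norm w * D" if "y \<in> K" for y
        using Cauchy_Schwarz_ineq2[of w "y - p"] mult_left_mono[OF D(2)[OF that pK], of "norm w"] by simp
      have "\<rho> / 2 \<le> norm w * D"
      proof (cases "u \<bullet> n \<ge> 0")
        case True
        let ?y = "c + \<rho> *\<^sub>R u"
        have yK: "?y \<in> K" using \<rho> u by (intro subsetD[OF \<rho>(2)]) (simp add: dist_norm)
        have "u \<bullet> (?y - p) = \<rho> - h"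
          using u by (simp add: h_def inner_diff_right inner_add_right norm_eq_1)
        moreover have "(u \<bullet> n) * (n \<bullet> (?y - p)) \<le> 0"
          using nrm[OF yK] True by (simp add: inner_diff_right mult_nonneg_nonpos)
        ultimately show ?thesis using split[of ?y] wD[OF yK] hd d(3) by linarith
      next
        case False
        let ?y = "c - \<rho> *\<^sub>R u"
        have yK: "?y \<in> K" using \<rho> u by (intro subsetD[OF \<rho>(2)]) (simp add: dist_norm)
        have "u \<bullet> (?y - p) = - \<rho> - h"
          using u by (simp add: h_def inner_diff_right norm_eq_1)
        moreover have "(u \<bullet> n) * (n \<bullet> (?y - p)) \<ge> 0"
          using nrm[OF yK] False by (simp add: inner_diff_right mult_nonpos_nonpos)
        ultimately show ?thesis using split[of ?y] wD[OF yK] hd d(3) by linarith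
      qed
      then show ?thesis using D by (simp add: \<omega>_def field_simps)
    qed
    have "norm g \<le> \<bar>h\<bar> + e * norm (p - c)"
      using norm_triangle_ineq[of "h *\<^sub>R u" "e *\<^sub>R (p - c)"] u e by (simp add: g_def height_grad_def h_def)
    also have "e * norm (p - c) \<le> e * D" using D(2)[OF pK cK] e by simp
    also have "e * D < e0 * D" using e D by simp
    finally have "norm g < r * \<omega> ^ 4 / 4" using hd d(4) e0(2) by simp
    then have "2 * norm g / r < \<omega> ^ 4 / 2" using r by (simp add: field_simps)
    moreover have "\<omega> ^ 4 \<le> norm w ^ 4" using wbound \<omega> by (intro power_mono) auto
    moreover have "\<omega> ^ 4 > 0" using \<omega> by simp
    ultimately show False using B by linarith
  qed
  then show ?thesis using that d(1) e0(1) by blast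
qed

text \<open>The first-order condition towards \<open>y\<close> fails at \<open>p0\<close> for \<open>e = 0\<close>, hence also for points near \<open>p0\<close>
  and small \<open>e\<close>.\<close>

lemma no_local_max_near_regular_point:
  fixes K :: "'a::euclidean_space set"
  assumes K: "convex K" "compact K" and c: "c \<in> interior K"
    and p0: "p0 \<in> frontier K" and y: "y \<in> K" "(u \<bullet> (p0 - c)) * (u \<bullet> (y - p0)) > 0"
  obtains d e0 where "d > 0" "e0 > 0"
    "\<And>e p. 0 < e \<Longrightarrow> e < e0 \<Longrightarrow> p \<in> ball p0 d \<Longrightarrow> p \<notin> local_max_points (height_form c u e) (frontier K)"
proof -
  define a where "a = (u \<bullet> (p0 - c)) * (u \<bullet> (y - p0))"
  define b where "b = (p0 - c) \<bullet> (y - p0)"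
  have a: "a > 0" using y by (simp add: a_def)
  have "isCont (\<lambda>p. (u \<bullet> (p - c)) * (u \<bullet> (y - p))) p0" by (intro continuous_intros)
  then obtain d1 where d1: "d1 > 0" "\<And>p. dist p p0 < d1 \<Longrightarrow> dist ((u \<bullet> (p - c)) * (u \<bullet> (y - p))) a < a / 2"
    using a unfolding continuous_at_eps_delta a_def by (metis half_gt_zero)
  have "isCont (\<lambda>p. (p - c) \<bullet> (y - p)) p0" by (intro continuous_intros)
  then obtain d2 where d2: "d2 > 0" "\<And>p. dist p p0 < d2 \<Longrightarrow> dist ((p - c) \<bullet> (y - p)) b < 1"
    unfolding continuous_at_eps_delta b_def by (metis zero_less_one)
  define e0 where "e0 = a / (2 * (\<bar>b\<bar> + 1))"
  have e0: "e0 > 0" "e0 * (\<bar>b\<bar> + 1) = a / 2" using a by (auto simp: e0_def field_simps)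
  have "p \<notin> local_max_points (height_form c u e) (frontier K)"
    if e: "0 < e" "e < e0" and p: "p \<in> ball p0 (min d1 d2)" for e p
  proof
    assume L: "p \<in> local_max_points (height_form c u e) (frontier K)"
    have L': "p \<in> local_max_points (height_form c u e) K"
      using e by (intro local_max_on_body[OF K c _ L] height_form_radial) auto
    have "(u \<bullet> (p - c)) * (u \<bullet> (y - p)) + e * ((p - c) \<bullet> (y - p)) \<le> 0"
      using local_max_first_order[OF K(1) L' _ y(1)] e by (simp add: height_grad_def inner_add_left)
    moreover have "\<bar>(u \<bullet> (p - c)) * (u \<bullet> (y - p)) - a\<bar> < a / 2"
      using d1(2)[of p] p by (simp add: dist_commute[of p0] dist_real_def)
    then have "a - a / 2 < (u \<bullet> (p - c)) * (u \<bullet> (y - p))" by (simp only: abs_diff_less_iff)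
    then have "(u \<bullet> (p - c)) * (u \<bullet> (y - p)) > a / 2" by simp
    moreover have "e * ((p - c) \<bullet> (y - p)) \<ge> - (a / 2)"
    proof -
      have "\<bar>(p - c) \<bullet> (y - p) - b\<bar> < 1"
        using d2(2)[of p] p by (simp add: dist_commute[of p0] dist_real_def)
      then have "(p - c) \<bullet> (y - p) \<ge> - (\<bar>b\<bar> + 1)" by linarith
      then have "e * ((p - c) \<bullet> (y - p)) \<ge> e * - (\<bar>b\<bar> + 1)" using e by (intro mult_left_mono) auto
      moreover have "e * (\<bar>b\<bar> + 1) \<le> e0 * (\<bar>b\<bar> + 1)" using e by (intro mult_right_mono) auto
      moreover have "e * - (\<bar>b\<bar> + 1) = - (e * (\<bar>b\<bar> + 1))" by (rule mult_minus_right)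
      ultimately show ?thesis using e0(2) by linarith
    qed
    ultimately show False by linarith
  qed
  then show ?thesis using that[of "min d1 d2" e0] d1(1) d2(1) e0(1) by simp
qed

text \<open>Let \<open>p \<noteq> q\<close> be local maxima with half gradients \<open>g p\<close> and \<open>g q\<close>. These are normal and of
  size at least \<open>M / 2\<close>, so strong monotonicity gives
  \<open>(g p - g q) \<bullet> (p - q) \<ge> M / 2 * \<kappa> * (norm (p - q))\<^sup>2\<close>. The left-hand side equals
  \<open>(u \<bullet> (p - q))\<^sup>2 + e * (norm (p - q))\<^sup>2\<close>, and the chord \<open>p - q\<close> is nearly orthogonal to \<open>u\<close>: the
  first-order conditions at both ends bound \<open>u \<bullet> (p - q)\<close> by a multiple of \<open>e * norm (p - q)\<close>.\<close>

lemma local_max_unique_near_pole: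
  fixes K :: "'a::euclidean_space set"
  assumes K: "convex K" "compact K" and c: "c \<in> interior K"
    and N: "N \<in> frontier K" "outer_normal K N u" and \<kappa>: "\<kappa> > 0" "d0 > 0"
    and mono: "\<And>p q n m. p \<in> frontier K \<inter> ball N d0 \<Longrightarrow> q \<in> frontier K \<inter> ball N d0 \<Longrightarrow>
      outer_normal K p n \<Longrightarrow> outer_normal K q m \<Longrightarrow>
      n \<bullet> (p - q) + m \<bullet> (q - p) \<ge> \<kappa> * (norm (p - q))\<^sup>2"
  obtains d e0 where "d > 0" "e0 > 0"
    "\<And>e p q. 0 < e \<Longrightarrow> e < e0 \<Longrightarrow> p \<in> ball N d \<Longrightarrow> q \<in> ball N d \<Longrightarrow>
      p \<in> local_max_points (height_form c u e) (frontier K) \<Longrightarrow>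
      q \<in> local_max_points (height_form c u e) (frontier K) \<Longrightarrow> p = q"
proof -
  have u: "norm u = 1" using N by (simp add: outer_normal_def)
  define M where "M = u \<bullet> (N - c)"
  have M: "M > 0" using interior_strictly_below_normal[OF c N(2)] by (simp add: M_def inner_diff_right)
  have fs: "frontier K \<subseteq> K" using K by (simp add: compact_imp_closed frontier_subset_closed)
  have cK: "c \<in> K" using c interior_subset by blast
  obtain D where D: "D > 0" "\<And>x y. x \<in> K \<Longrightarrow> y \<in> K \<Longrightarrow> norm (x - y) \<le> D"
    using compact_diameter_bound[OF K(2)] by metis
  \<comment> \<open>For \<open>e \<le> 1\<close> the quantity \<open>(u \<bullet> (p - q))\<^sup>2 + e * (norm (p - q))\<^sup>2\<close> will be at most
    \<open>e * C * (norm (p - q))\<^sup>2\<close>.\<close>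
  define C where "C = (2 * D / M)\<^sup>2 + 1"
  have C: "C > 0" by (simp add: C_def add_nonneg_pos)
  define e0 where "e0 = min 1 (M / 2 * \<kappa> / C)"
  have e0: "e0 > 0" "e0 \<le> 1" "e0 * C \<le> M / 2 * \<kappa>"
  proof -
    show "e0 > 0" "e0 \<le> 1" using M \<kappa> C by (auto simp: e0_def)
    have "e0 \<le> M / 2 * \<kappa> / C" unfolding e0_def by (rule min.cobounded2)
    then show "e0 * C \<le> M / 2 * \<kappa>" using C by (simp only: pos_le_divide_eq)
  qed
  define d where "d = min d0 (M / 2)"
  have d: "d > 0" "d \<le> d0" "d \<le> M / 2" using \<kappa> M by (auto simp: d_def)
  have "p = q" if e: "0 < e" "e < e0" and pq: "p \<in> ball N d" "q \<in> ball N d"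
    and L: "p \<in> local_max_points (height_form c u e) (frontier K)"
      "q \<in> local_max_points (height_form c u e) (frontier K)" for e p q
  proof (rule ccontr)
    assume neq: "p \<noteq> q"
    define g where "g = height_grad c u e"
    have basic: "x \<in> frontier K" "x \<in> K" "outer_normal K x (sgn (g x))" "norm (g x) \<ge> M / 2"
      "u \<bullet> (x - c) \<ge> M / 2" "\<And>y. y \<in> K \<Longrightarrow> g x \<bullet> (y - x) \<le> 0"
      if x: "x \<in> ball N d" "x \<in> local_max_points (height_form c u e) (frontier K)" for x
    proof -
      show xf: "x \<in> frontier K" using x by (simp add: local_max_points_def)
      then show "x \<in> K" using fs by blast
      have xc: "x \<noteq> c" using xf c by (auto simp: frontier_def)
      have L': "x \<in> local_max_points (height_form c u e) K"
        using e by (intro local_max_on_body[OF K c _ x(2)] height_form_radial) auto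
      show "outer_normal K x (sgn (g x))"
        unfolding g_def by (rule outer_normal_at_local_max[OF K(1) L' e(1) xc])
      show "g x \<bullet> (y - x) \<le> 0" if "y \<in> K" for y
        unfolding g_def using local_max_first_order[OF K(1) L' _ that] e by simp
      have "u \<bullet> (x - c) = M - u \<bullet> (N - x)" by (simp add: M_def inner_diff_right)
      moreover have "\<bar>u \<bullet> (N - x)\<bar> < M / 2"
        using Cauchy_Schwarz_ineq2[of u "N - x"] u x(1) d(3) by (simp add: dist_norm)
      ultimately show h: "u \<bullet> (x - c) \<ge> M / 2" by linarith
      have "u \<bullet> g x = u \<bullet> (x - c) + e * (u \<bullet> (x - c))"
        using u by (simp add: g_def height_grad_def inner_add_right norm_eq_1)
      moreover have "e * (u \<bullet> (x - c)) \<ge> 0" using h e M by simp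
      moreover have "u \<bullet> g x \<le> norm (g x)" using norm_cauchy_schwarz[of u "g x"] u by simp
      ultimately show "norm (g x) \<ge> M / 2" using h by linarith
    qed
    note P = basic[OF pq(1) L(1)] and Q = basic[OF pq(2) L(2)]
    have dpq: "norm (p - q) > 0" using neq by simp
    have flat: "u \<bullet> (y - x) \<le> 2 * D / M * e * norm (x - y)"
      if x: "u \<bullet> (x - c) \<ge> M / 2" "g x \<bullet> (y - x) \<le> 0" "x \<in> K" for x y
    proof -
      have "(u \<bullet> (x - c)) * (u \<bullet> (y - x)) \<le> e * ((x - c) \<bullet> (x - y))"
        using x(2) by (simp add: g_def height_grad_def inner_add_left inner_diff_right algebra_simps)
      also have "\<dots> \<le> e * (D * norm (x - y))"
      proof -
        have "(x - c) \<bullet> (x - y) \<le> norm (x - c) * norm (x - y)" by (rule norm_cauchy_schwarz)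
        also have "\<dots> \<le> D * norm (x - y)" using D(2)[OF x(3) cK] by (intro mult_right_mono) auto
        finally show ?thesis using e by simp
      qed
      finally have *: "(u \<bullet> (x - c)) * (u \<bullet> (y - x)) \<le> e * (D * norm (x - y))" .
      show ?thesis
      proof (cases "u \<bullet> (y - x) \<le> 0")
        case True
        moreover have "0 \<le> 2 * D / M * e * norm (x - y)" using D M e by simp
        ultimately show ?thesis by linarith
      next
        case False
        then have "M / 2 * (u \<bullet> (y - x)) \<le> (u \<bullet> (x - c)) * (u \<bullet> (y - x))"
          using x(1) by (intro mult_right_mono) auto
        then have "M / 2 * (u \<bullet> (y - x)) \<le> e * (D * norm (x - y))" using * by linarith
        then show ?thesis using M by (simp add: field_simps)
      qed
    qed
    have "\<bar>u \<bullet> (p - q)\<bar> \<le> 2 * D / M * e * norm (p - q)"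
      using flat[OF P(5) P(6)[OF Q(2)] P(2)] flat[OF Q(5) Q(6)[OF P(2)] Q(2)]
      by (simp add: inner_diff_right norm_minus_commute abs_le_iff)
    then have "(u \<bullet> (p - q))\<^sup>2 \<le> (2 * D / M * e * norm (p - q))\<^sup>2"
      by (metis abs_ge_zero power2_abs power_mono)
    also have "\<dots> = (2 * D / M)\<^sup>2 * e\<^sup>2 * (norm (p - q))\<^sup>2" by (simp only: power_mult_distrib)
    also have "\<dots> \<le> (2 * D / M)\<^sup>2 * e * (norm (p - q))\<^sup>2"
      using e e0(2) by (intro mult_right_mono mult_left_mono) (auto simp: power2_eq_square mult_left_le)
    finally have sq: "(u \<bullet> (p - q))\<^sup>2 + e * (norm (p - q))\<^sup>2 \<le> e * C * (norm (p - q))\<^sup>2"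
      by (simp add: C_def algebra_simps)
    have eq: "g p \<bullet> (p - q) + g q \<bullet> (q - p) = (u \<bullet> (p - q))\<^sup>2 + e * (norm (p - q))\<^sup>2"
    proof -
      have "g p \<bullet> (p - q) + g q \<bullet> (q - p) = (g p - g q) \<bullet> (p - q)"
        by (simp add: inner_diff_left inner_diff_right)
      also have "g p - g q = (u \<bullet> (p - q)) *\<^sub>R u + e *\<^sub>R (p - q)"
        by (simp add: g_def height_grad_def inner_diff_right algebra_simps)
      also have "\<dots> \<bullet> (p - q) = (u \<bullet> (p - q))\<^sup>2 + e * (norm (p - q))\<^sup>2"
        by (simp only: inner_add_left inner_scaleR_left power2_eq_square[of "u \<bullet> (p - q)"] power2_norm_eq_inner)
      finally show ?thesis .
    qed
    have scale: "g x \<bullet> (x - y) \<ge> M / 2 * (sgn (g x) \<bullet> (x - y))"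
      if "norm (g x) \<ge> M / 2" "g x \<bullet> (y - x) \<le> 0" for x y
    proof -
      have gs: "g x \<bullet> (x - y) = norm (g x) * (sgn (g x) \<bullet> (x - y))"
        by (cases "g x = 0") (simp_all add: sgn_div_norm)
      have "g x \<bullet> (x - y) \<ge> 0" using that(2) by (simp add: inner_diff_right)
      then have "sgn (g x) \<bullet> (x - y) \<ge> 0"
        by (simp add: sgn_div_norm)
      then show ?thesis unfolding gs using that(1) by (intro mult_right_mono)
    qed
    have "M / 2 * (\<kappa> * (norm (p - q))\<^sup>2) \<le> M / 2 * (sgn (g p) \<bullet> (p - q) + sgn (g q) \<bullet> (q - p))"
      using mono[OF _ _ P(3) Q(3)] P(1) Q(1) pq d(2) M by (intro mult_left_mono) auto
    also have "\<dots> \<le> g p \<bullet> (p - q) + g q \<bullet> (q - p)"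
      using scale[OF P(4) P(6)[OF Q(2)]] scale[OF Q(4) Q(6)[OF P(2)]] by (simp add: distrib_left)
    also have "\<dots> \<le> e * C * (norm (p - q))\<^sup>2" using sq eq by simp
    also have "\<dots> < e0 * C * (norm (p - q))\<^sup>2" using e C dpq by simp
    also have "\<dots> \<le> M / 2 * \<kappa> * (norm (p - q))\<^sup>2" using e0(3) by (intro mult_right_mono) auto
    finally show False by simp
  qed
  then show ?thesis using that[OF d(1) e0(1)] by blast
qed

text \<open>Maximize over the closed upper half of the boundary. The maximum is at least the square of
  the height \<open>\<delta>\<close> of some boundary point, whereas on the equator the values are at most
  \<open>e * B\<^sup>2 < \<delta>\<^sup>2\<close>; so it is attained off the equator and is a local maximum on the whole boundary.\<close>

lemma local_max_exists_above:
  fixes K :: "'a::euclidean_space set"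
  assumes K: "compact K" and c: "c \<in> interior K" and u: "norm u = 1"
  obtains e0 where "e0 > 0"
    "\<And>e. 0 < e \<Longrightarrow> e < e0 \<Longrightarrow>
      \<exists>p \<in> local_max_points (height_form c u e) (frontier K). u \<bullet> (p - c) > 0"
proof -
  have "u \<noteq> 0" using u by auto
  then obtain \<delta> where \<delta>: "\<delta> > 0" "c + \<delta> *\<^sub>R u \<in> frontier K"
    using ray_to_frontier[OF compact_imp_bounded[OF K] c] by metis
  define x1 where "x1 = c + \<delta> *\<^sub>R u"
  have x1: "x1 \<in> frontier K" "u \<bullet> (x1 - c) = \<delta>"
    using \<delta> u by (simp_all add: x1_def norm_eq_1)
  define S where "S = frontier K \<inter> {x. u \<bullet> c \<le> u \<bullet> x}"
  have S: "compact S"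
    unfolding S_def using K by (intro compact_Int_closed compact_frontier closed_halfspace_ge) 
  have x1S: "x1 \<in> S" using x1 \<delta> by (simp add: S_def inner_diff_right)
  obtain B where B: "B > 0" "\<And>x. x \<in> K \<Longrightarrow> norm (x - c) \<le> B"
  proof -
    obtain B where "B > 0" "K \<subseteq> ball c B" using compact_imp_bounded[OF K] bounded_subset_ballD by metis
    then show ?thesis using that[of B] by (force simp: dist_norm norm_minus_commute)
  qed
  have fs: "frontier K \<subseteq> K" using K by (simp add: compact_imp_closed frontier_subset_closed)
  show ?thesis
  proof (rule that[of "\<delta>\<^sup>2 / B\<^sup>2"])
    show "\<delta>\<^sup>2 / B\<^sup>2 > 0" using \<delta> B by simp
    fix e assume e: "0 < e" "e < \<delta>\<^sup>2 / B\<^sup>2"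
    have "continuous_on S (height_form c u e)"
      unfolding height_form_def by (intro continuous_intros)
    then obtain p where p: "p \<in> S" "\<And>x. x \<in> S \<Longrightarrow> height_form c u e x \<le> height_form c u e p"
      using continuous_attains_sup[OF S] x1S by blast
    have pf: "p \<in> frontier K" using p by (simp add: S_def)
    have pos: "u \<bullet> (p - c) > 0"
    proof (rule ccontr)
      assume "\<not> ?thesis"
      then have h0: "u \<bullet> (p - c) = 0" using p(1) by (simp add: S_def inner_diff_right)
      have "\<delta>\<^sup>2 \<le> height_form c u e x1"
        using x1(2) e by (simp add: height_form_def del: inner_diff_right)
      also have "\<dots> \<le> height_form c u e p" by (rule p(2)[OF x1S])
      also have "\<dots> = e * (norm (p - c))\<^sup>2" by (simp only: height_form_def h0) simp
      also have "\<dots> \<le> e * B\<^sup>2"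
        using B(2)[of p] pf fs e by (intro mult_left_mono power_mono) auto
      also have "\<dots> < \<delta>\<^sup>2" using e B by (simp add: pos_less_divide_eq)
      finally show False by simp
    qed
    have "height_form c u e q \<le> height_form c u e p"
      if q: "q \<in> frontier K" "q \<in> ball p (u \<bullet> (p - c))" for q
    proof -
      have "u \<bullet> (p - q) \<le> norm (p - q)" using norm_cauchy_schwarz[of u "p - q"] u by simp
      also have "\<dots> < u \<bullet> (p - c)" using q(2) by (simp only: mem_ball dist_norm)
      finally have "u \<bullet> c \<le> u \<bullet> q" by (simp add: inner_diff_right)
      then show ?thesis using q p(2) by (simp add: S_def)
    qed
    then have "p \<in> local_max_points (height_form c u e) (frontier K)"
      using pf pos unfolding local_max_points_def by blast
    then show "\<exists>p \<in> local_max_points (height_form c u e) (frontier K). u \<bullet> (p - c) > 0"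
      using pos by blast
  qed
qed

section \<open>The number of local maxima\<close>

text \<open>All points of the segment from \<open>p\<close> to \<open>q\<close> have the normal \<open>u\<close>, which contradicts strong monotonicity
  of the normals near \<open>p\<close> unless the segment is trivial.\<close>

lemma pole_unique:
  fixes K :: "(real ^ 'n) set"
  assumes K: "Ck_convex_body 3 K" and curv: "\<forall>x\<in>frontier K. gaussian_curvature K x \<noteq> 0"
    and p: "p \<in> frontier K" "outer_normal K p u" and q: "q \<in> frontier K" "outer_normal K q u"
  shows "p = q"
proof -
  have K': "convex K" "closed K"
    using K by (auto simp: Ck_convex_body_def convex_body_def compact_imp_closed)
  have fs: "frontier K \<subseteq> K" using K' by (simp add: frontier_subset_closed)
  have pq: "p \<in> K" "q \<in> K" "norm u = 1" "\<And>y. y \<in> K \<Longrightarrow> u \<bullet> y \<le> u \<bullet> p" "u \<bullet> p = u \<bullet> q"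
    using p q fs by (auto simp: outer_normal_def intro!: antisym)
  obtain \<kappa> d where \<kappa>: "\<kappa> > 0" "d > 0"
    "\<And>x y n m. x \<in> frontier K \<inter> ball p d \<Longrightarrow> y \<in> frontier K \<inter> ball p d \<Longrightarrow>
      outer_normal K x n \<Longrightarrow> outer_normal K y m \<Longrightarrow>
      n \<bullet> (x - y) + m \<bullet> (y - x) \<ge> \<kappa> * (norm (x - y))\<^sup>2"
    using strongly_monotone_normals_at_curved_point[OF K p(1) curv[rule_format, OF p(1)] p(2)] by metis
  obtain s where s: "0 < s" "p + s *\<^sub>R (q - p) \<in> K \<inter> ball p d"
    using small_step_in_convex[OF K'(1) pq(1,2) \<kappa>(2)] by metis
  define x where "x = p + s *\<^sub>R (q - p)"
  have xK: "x \<in> K" and xb: "x \<in> ball p d" using s by (simp_all add: x_def)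
  have ux: "u \<bullet> x = u \<bullet> p" using pq(5) by (simp add: x_def inner_add_right inner_diff_right)
  then have xn: "outer_normal K x u" using pq by (simp add: outer_normal_def)
  then have "x \<notin> interior K" using interior_strictly_below_normal by blast
  then have "x \<in> frontier K" using xK K' by (simp add: frontier_def)
  then have "\<kappa> * (norm (p - x))\<^sup>2 \<le> u \<bullet> (p - x) + u \<bullet> (x - p)"
    using xb p xn \<kappa> by (intro \<kappa>(3)) auto
  then have "\<kappa> * (norm (p - x))\<^sup>2 \<le> 0" by (simp add: inner_diff_right)
  then have "p = x" using \<kappa>(1) by (simp add: mult_le_0_iff)
  then show ?thesis using s by (simp add: x_def)
qed

lemma local_max_structure_near_boundary_point:
  fixes K :: "(real ^ 'n) set"
  assumes K: "Ck_convex_body 3 K" and curv: "\<forall>x\<in>frontier K. gaussian_curvature K x \<noteq> 0"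
    and c: "c \<in> interior K" and u: "norm u = 1" and x: "x \<in> frontier K"
  shows "\<exists>d>0. \<exists>e0>0. \<forall>e. 0 < e \<longrightarrow> e < e0 \<longrightarrow>
    (\<forall>p \<in> ball x d \<inter> local_max_points (height_form c u e) (frontier K).
     \<forall>q \<in> ball x d \<inter> local_max_points (height_form c u e) (frontier K).
      p = q \<and> (outer_normal K x u \<or> outer_normal K x (- u)))"
proof -
  have K': "convex K" "compact K"
    using K by (auto simp: Ck_convex_body_def convex_body_def)
  have pole: ?thesis if v: "v = u \<or> v = - u" and n: "outer_normal K x v" for v
  proof -
    obtain \<kappa> d0 where \<kappa>: "\<kappa> > 0" "d0 > 0"
      "\<And>p q n m. p \<in> frontier K \<inter> ball x d0 \<Longrightarrow> q \<in> frontier K \<inter> ball x d0 \<Longrightarrow>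
        outer_normal K p n \<Longrightarrow> outer_normal K q m \<Longrightarrow>
        n \<bullet> (p - q) + m \<bullet> (q - p) \<ge> \<kappa> * (norm (p - q))\<^sup>2"
      using strongly_monotone_normals_at_curved_point[OF K x curv[rule_format, OF x] n] by metis
    obtain d e0 where "d > 0" "e0 > 0"
      "\<And>e p q. 0 < e \<Longrightarrow> e < e0 \<Longrightarrow> p \<in> ball x d \<Longrightarrow> q \<in> ball x d \<Longrightarrow>
        p \<in> local_max_points (height_form c v e) (frontier K) \<Longrightarrow>
        q \<in> local_max_points (height_form c v e) (frontier K) \<Longrightarrow> p = q"
      using local_max_unique_near_pole[OF K' c x n \<kappa>] by blast
    moreover have "height_form c v = height_form c u" using v by auto
    ultimately show ?thesis using v n by (intro exI[of _ d] conjI exI[of _ e0]) auto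
  qed
  have empty: ?thesis if "d > 0" "e0 > 0"
    "\<And>e p. 0 < e \<Longrightarrow> e < e0 \<Longrightarrow> p \<in> ball x d \<Longrightarrow> p \<notin> local_max_points (height_form c u e) (frontier K)"
    for d e0 :: real
    using that by (intro exI[of _ d] conjI exI[of _ e0]) auto
  consider "u \<bullet> (x - c) = 0" | "outer_normal K x u" | "outer_normal K x (- u)"
    | y where "y \<in> K" "(u \<bullet> (x - c)) * (u \<bullet> (y - x)) > 0"
  proof -
    have "\<exists>y\<in>K. (u \<bullet> (x - c)) * (u \<bullet> (y - x)) > 0"
      if "u \<bullet> (x - c) > 0" "\<not> outer_normal K x u"
    proof -
      have "\<not> (\<forall>y\<in>K. u \<bullet> y \<le> u \<bullet> x)" using that(2) u by (simp add: outer_normal_def)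
      then obtain y where "y \<in> K" "u \<bullet> y > u \<bullet> x" by (meson not_le)
      then show ?thesis using that(1) by (intro bexI[of _ y] mult_pos_pos) (auto simp: inner_diff_right)
    qed
    moreover have "\<exists>y\<in>K. (u \<bullet> (x - c)) * (u \<bullet> (y - x)) > 0"
      if "u \<bullet> (x - c) < 0" "\<not> outer_normal K x (- u)"
    proof -
      have "\<not> (\<forall>y\<in>K. u \<bullet> x \<le> u \<bullet> y)" using that(2) u by (simp add: outer_normal_def)
      then obtain y where "y \<in> K" "u \<bullet> y < u \<bullet> x" by (meson not_le)
      then show ?thesis using that(1) by (intro bexI[of _ y] mult_neg_neg) (auto simp: inner_diff_right)
    qed
    ultimately show thesis using that by (metis linorder_neqE_linordered_idom)
  qed
  then show ?thesis
  proof cases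
    case 1
    then show ?thesis using no_local_max_near_equator[OF K c u x] empty by metis
  next
    case 4
    then show ?thesis using no_local_max_near_regular_point[OF K' c x] empty by metis
  next
    case 2
    show ?thesis by (rule pole[OF _ 2]) simp
  next
    case 3
    show ?thesis by (rule pole[OF _ 3]) simp
  qed
qed

lemma card_le_one:
  assumes "\<And>x y. x \<in> A \<Longrightarrow> y \<in> A \<Longrightarrow> x = y"
  shows "finite A \<and> card A \<le> 1"
proof (cases "A = {}")
  case False
  then obtain a where "A = {a}" using assms by blast
  then show ?thesis by simp
qed simp

text \<open>A finite subcover of the boundary by neighbourhoods as above contains at most two that belong to
  poles; only these contain local maxima, and at most one each.\<close>

lemma exactly_two_local_max:
  fixes K :: "(real ^ 'n) set"
  assumes K: "Ck_convex_body 3 K" and curv: "\<forall>x\<in>frontier K. gaussian_curvature K x \<noteq> 0"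
    and c: "c \<in> interior K" and u: "norm u = 1"
  obtains e0 where "e0 > 0"
    "\<And>e. 0 < e \<Longrightarrow> e < e0 \<Longrightarrow> card (local_max_points (height_form c u e) (frontier K)) = 2"
proof -
  define L where "L e = local_max_points (height_form c u e) (frontier K)" for e
  have K': "compact K" using K by (auto simp: Ck_convex_body_def convex_body_def)
  have LF: "L e \<subseteq> frontier K" for e by (auto simp: L_def local_max_points_def)
  obtain d e1 where de: "\<And>x. x \<in> frontier K \<Longrightarrow> d x > 0" "\<And>x. x \<in> frontier K \<Longrightarrow> e1 x > 0"
    "\<And>x e p q. x \<in> frontier K \<Longrightarrow> 0 < e \<Longrightarrow> e < e1 x \<Longrightarrow> p \<in> ball x (d x) \<inter> L e \<Longrightarrow> q \<in> ball x (d x) \<inter> L e \<Longrightarrow>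
      p = q \<and> (outer_normal K x u \<or> outer_normal K x (- u))"
    using local_max_structure_near_boundary_point[OF K curv c u] unfolding L_def by metis
  have "frontier K \<subseteq> (\<Union>x\<in>frontier K. ball x (d x))" using de(1) by force
  then obtain T where T: "T \<subseteq> frontier K" "finite T" "frontier K \<subseteq> (\<Union>x\<in>T. ball x (d x))"
    using compactE_image[OF compact_frontier[OF K'], of "frontier K" "\<lambda>x. ball x (d x)"] by (metis open_ball)
  define P where "P = {x \<in> T. outer_normal K x u \<or> outer_normal K x (- u)}"
  have finP: "finite P" using T by (simp add: P_def)
  have cardP: "card P \<le> 2"
  proof -
    have "card {x \<in> T. outer_normal K x v} \<le> 1" for v
      using T(1) by (intro card_le_one[THEN conjunct2] pole_unique[OF K curv]) auto
    from add_mono[OF this[of u] this[of "- u"]]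
    have "card {x \<in> T. outer_normal K x u} + card {x \<in> T. outer_normal K x (- u)} \<le> 2" by simp
    moreover have "P = {x \<in> T. outer_normal K x u} \<union> {x \<in> T. outer_normal K x (- u)}"
      by (auto simp: P_def)
    ultimately show ?thesis
      using card_Un_le[of "{x \<in> T. outer_normal K x u}" "{x \<in> T. outer_normal K x (- u)}"]
      by simp
  qed
  obtain e2 where e2: "e2 > 0" "\<And>e. 0 < e \<Longrightarrow> e < e2 \<Longrightarrow> \<exists>p\<in>L e. u \<bullet> (p - c) > 0"
    using local_max_exists_above[OF K' c u] unfolding L_def by metis
  obtain e3 where e3: "e3 > 0" "\<And>e. 0 < e \<Longrightarrow> e < e3 \<Longrightarrow> \<exists>p\<in>L e. (- u) \<bullet> (p - c) > 0"
    using local_max_exists_above[OF K' c, of "- u"] u unfolding L_def height_form_minus by (metis norm_minus_cancel)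
  define e0 where "e0 = Min (insert e2 (insert e3 (e1 ` T)))"
  have e0: "e0 > 0" "e0 \<le> e2" "e0 \<le> e3" "\<And>x. x \<in> T \<Longrightarrow> e0 \<le> e1 x"
  proof -
    have fin: "finite (insert e2 (insert e3 (e1 ` T)))" using T by simp
    have "\<forall>a\<in>insert e2 (insert e3 (e1 ` T)). a > 0" using e2 e3 de(2) T(1) by blast
    then show "e0 > 0" unfolding e0_def using Min_in[OF fin] by blast
    show "e0 \<le> e2" "e0 \<le> e3" "\<And>x. x \<in> T \<Longrightarrow> e0 \<le> e1 x"
      unfolding e0_def by (intro Min_le[OF fin]; simp)+
  qed
  have "card (L e) = 2" if e: "0 < e" "e < e0" for e
  proof -
    have small: "e < e1 x" if "x \<in> T" for x using e e0(4)[OF that] by simp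
    have one: "finite (ball x (d x) \<inter> L e) \<and> card (ball x (d x) \<inter> L e) \<le> 1" if "x \<in> T" for x
      using de(3)[OF _ e(1) small[OF that]] that T(1) by (intro card_le_one) blast
    have sub: "L e \<subseteq> (\<Union>x\<in>P. ball x (d x) \<inter> L e)"
    proof
      fix p assume p: "p \<in> L e"
      then obtain x where x: "x \<in> T" "p \<in> ball x (d x)" using LF T(3) by blast
      then have "x \<in> P" using de(3)[OF _ e(1) small[OF x(1)], of p p] p T(1) by (auto simp: P_def)
      then show "p \<in> (\<Union>x\<in>P. ball x (d x) \<inter> L e)" using x p by blast
    qed
    have PT: "P \<subseteq> T" by (auto simp: P_def)
    have finU: "finite (\<Union>x\<in>P. ball x (d x) \<inter> L e)" using finP one PT by blast
    have finL: "finite (L e)" using finite_subset[OF sub finU] .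
    have "card (L e) \<le> card (\<Union>x\<in>P. ball x (d x) \<inter> L e)" by (rule card_mono[OF finU sub])
    also have "\<dots> \<le> (\<Sum>x\<in>P. card (ball x (d x) \<inter> L e))" by (rule card_UN_le[OF finP])
    also have "\<dots> \<le> (\<Sum>x\<in>P. 1)" using one PT by (intro sum_mono) blast
    also have "\<dots> \<le> 2" using cardP by simp
    finally have le: "card (L e) \<le> 2" .
    obtain p where p: "p \<in> L e" "u \<bullet> (p - c) > 0" using e2(2)[of e] e e0 by auto
    obtain q where q: "q \<in> L e" "(- u) \<bullet> (q - c) > 0" using e3(2)[of e] e e0 by auto
    have "p \<noteq> q" using p q by auto
    then have "card {p, q} = 2" by simp
    moreover have "card {p, q} \<le> card (L e)" using p q finL by (intro card_mono) auto
    ultimately show ?thesis using le by simp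
  qed
  then show ?thesis using that e0(1) unfolding L_def by blast
qed


section \<open>Centers of mass\<close>

text \<open>A copy of the index type, ordered by an injection into the natural numbers. Renaming the coordinates
  preserves the Lebesgue measure, and so carries the change of variables formula, which
  concerns well-ordered index types, over to all finite index types.\<close>

typedef 'n ordered_index = "UNIV :: 'n set"
  morphisms index_of Ordered_index by simp

instance ordered_index :: (finite) finite
proof
  have "(UNIV :: 'a ordered_index set) = range Ordered_index"
    by (metis UNIV_I index_of_inverse surjI)
  then show "finite (UNIV :: 'a ordered_index set)"
    by (metis finite finite_imageI)
qed

instantiation ordered_index :: (finite) wellorder
begin

definition less_eq_ordered_index :: "'a ordered_index \<Rightarrow> 'a ordered_index \<Rightarrow> bool" where
  "x \<le> y \<longleftrightarrow> to_nat (index_of x) \<le> to_nat (index_of y)"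

definition less_ordered_index :: "'a ordered_index \<Rightarrow> 'a ordered_index \<Rightarrow> bool" where
  "x < y \<longleftrightarrow> to_nat (index_of x) < to_nat (index_of y)"

instance
proof
  fix x y z :: "'a ordered_index"
  show "x < y \<longleftrightarrow> x \<le> y \<and> \<not> y \<le> x" "x \<le> x" "x \<le> y \<or> y \<le> x"
    unfolding less_eq_ordered_index_def less_ordered_index_def by linarith+
  show "x \<le> y \<Longrightarrow> y \<le> z \<Longrightarrow> x \<le> z"
    unfolding less_eq_ordered_index_def by (rule order_trans)
  show "x \<le> y \<Longrightarrow> y \<le> x \<Longrightarrow> x = y"
    unfolding less_eq_ordered_index_def by (metis from_nat_to_nat index_of_inverse order_antisym)
next
  fix P :: "'a ordered_index \<Rightarrow> bool" and a
  assume *: "\<And>x. (\<And>y. y < x \<Longrightarrow> P y) \<Longrightarrow> P x"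
  show "P a"
  proof (induction a rule: measure_induct_rule[of "\<lambda>x. to_nat (index_of x)"])
    case (less x)
    show ?case by (rule *, rule less, simp add: less_ordered_index_def)
  qed
qed

end

definition relabel :: "real ^ 'n \<Rightarrow> real ^ 'n ordered_index" where
  "relabel x = (\<chi> i. x $ index_of i)"

definition unlabel :: "real ^ 'n ordered_index \<Rightarrow> real ^ 'n" where
  "unlabel y = (\<chi> j. y $ Ordered_index j)"

lemma unlabel_relabel [simp]: "unlabel (relabel x) = x"
  and relabel_unlabel [simp]: "relabel (unlabel y) = y"
  by (simp_all add: relabel_def unlabel_def vec_eq_iff Ordered_index_inverse index_of_inverse)

lemma linear_relabel: "linear (relabel :: real ^ 'n \<Rightarrow> _)"
  and linear_unlabel: "linear (unlabel :: _ \<Rightarrow> real ^ 'n)"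
  by (auto intro!: linearI simp: relabel_def unlabel_def vec_eq_iff)

lemma bij_index_of: "bij (index_of :: 'n ordered_index \<Rightarrow> 'n)"
  by (metis Ordered_index_inverse UNIV_I bijI' index_of_inject)

lemma relabel_measurable [measurable]: "(relabel :: real ^ 'n \<Rightarrow> _) \<in> borel_measurable borel"
  using linear_relabel
  by (intro borel_measurable_continuous_onI linear_continuous_on) (simp add: linear_conv_bounded_linear)

lemma lborel_relabel: "(lborel :: (real ^ 'n::finite ordered_index) measure) = distr lborel borel relabel"
proof (rule lborel_eqI)
  have Basis: "(Basis :: (real ^ 'm::finite) set) = range (\<lambda>i. axis i 1)"
    by (auto simp: Basis_vec_def)
  have inj: "inj (\<lambda>i. axis i 1 :: real ^ 'm::finite)"
    by (auto simp: inj_on_def axis_eq_axis)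
  have prod: "(\<Prod>b\<in>Basis. x \<bullet> b) = (\<Prod>i\<in>UNIV. x $ i)" for x :: "real ^ 'm::finite"
    unfolding Basis by (subst prod.reindex[OF inj]) (simp add: inner_axis)
  fix l u :: "real ^ 'n ordered_index"
  assume le: "\<And>b. b \<in> Basis \<Longrightarrow> l \<bullet> b \<le> u \<bullet> b"
  have le': "unlabel l \<bullet> b \<le> unlabel u \<bullet> b" if "b \<in> Basis" for b
    using that le[of "axis (Ordered_index _) 1"] by (auto simp: Basis inner_axis unlabel_def)
  have box: "relabel -` box l u = box (unlabel l) (unlabel u)"
  proof -
    have "x \<in> relabel -` box l u \<longleftrightarrow> x \<in> box (unlabel l) (unlabel u)" for x :: "real ^ 'n"
      by (auto simp: mem_box_cart relabel_def unlabel_def)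
         (metis Ordered_index_inverse UNIV_I index_of_inverse)+
    then show ?thesis by blast
  qed
  have "emeasure (distr lborel borel relabel) (box l u)
      = emeasure lborel (box (unlabel l) (unlabel u))"
    by (subst emeasure_distr) (simp_all add: box)
  also have "\<dots> = ennreal (\<Prod>b\<in>Basis. (unlabel u - unlabel l) \<bullet> b)"
    using le' by (subst emeasure_lborel_box) auto
  also have "(\<Prod>b\<in>Basis. (unlabel u - unlabel l) \<bullet> b)
      = (\<Prod>i\<in>UNIV. (u - l) $ Ordered_index i)"
    by (simp add: prod unlabel_def)
  also have "\<dots> = (\<Prod>i\<in>UNIV. (u - l) $ i)"
    by (subst prod.reindex_bij_betw[OF bij_index_of, symmetric]) (simp add: index_of_inverse)
  also have "\<dots> = (\<Prod>b\<in>Basis. (u - l) \<bullet> b)"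
    by (simp add: prod)
  finally show "emeasure (distr lborel borel relabel) (box l u)
      = ennreal (\<Prod>b\<in>Basis. (u - l) \<bullet> b)" .
qed simp

lemma center_of_mass_lborel:
  fixes K :: "'a::euclidean_space set"
  assumes "compact K"
  shows "center_of_mass K
    = (1 / measure lborel K) *\<^sub>R (LINT x|lborel. indicator K x *\<^sub>R x)"
proof -
  have "set_integrable lborel K (\<lambda>x. x)"
    unfolding set_integrable_def by (rule borel_integrable_compact) (auto simp: assms)
  then have "(LINT x|lborel. indicator K x *\<^sub>R x) = integral K (\<lambda>x. x)"
    using set_borel_integral_eq_integral(2) by (metis set_lebesgue_integral_def)
  moreover have "measure lebesgue K = measure lborel K"
    using assms by (simp add: borel_compact)
  ultimately show ?thesis by (simp add: center_of_mass_def)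
qed

lemma relabel_in_image_iff: "relabel x \<in> relabel ` K \<longleftrightarrow> x \<in> K"
  by (metis image_iff unlabel_relabel)

lemma compact_relabel:
  fixes K :: "(real ^ 'n) set"
  shows "compact K \<Longrightarrow> compact (relabel ` K)"
  using linear_relabel
  by (intro compact_continuous_image linear_continuous_on) (simp add: linear_conv_bounded_linear)

lemma measure_relabel:
  fixes K :: "(real ^ 'n) set"
  assumes "compact K"
  shows "measure lborel (relabel ` K) = measure lborel K"
proof -
  have "relabel -` relabel ` K = K" by (rule set_eqI) (simp only: vimage_eq relabel_in_image_iff)
  then show ?thesis
    using borel_compact[OF compact_relabel[OF assms]]
    by (subst lborel_relabel, subst measure_distr) auto
qed

lemma center_of_mass_relabel:
  fixes K :: "(real ^ 'n) set"
  assumes K: "compact K"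
  shows "center_of_mass (relabel ` K) = relabel (center_of_mass K)"
proof -
  have bl: "bounded_linear (relabel :: real ^ 'n \<Rightarrow> _)"
    using linear_relabel linear_conv_bounded_linear by blast
  have [measurable]: "relabel ` K \<in> sets borel" "K \<in> sets borel"
    using K compact_relabel[OF K] by (auto intro: borel_compact)
  have "(LINT y|lborel. indicator (relabel ` K) y *\<^sub>R y)
      = (LINT x|lborel. indicator (relabel ` K) (relabel x) *\<^sub>R relabel x)"
    by (subst lborel_relabel, subst integral_distr) auto
  also have "\<dots> = (LINT x|lborel. relabel (indicator K x *\<^sub>R x))"
    by (intro Bochner_Integration.integral_cong) (auto simp: relabel_in_image_iff indicator_def linear_0[OF linear_relabel])
  also have "\<dots> = relabel (LINT x|lborel. indicator K x *\<^sub>R x)"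
    by (intro integral_bounded_linear bl borel_integrable_compact K) auto
  finally show ?thesis
    by (simp add: center_of_mass_lborel K compact_relabel measure_relabel linear_cmul[OF linear_relabel])
qed

lemma has_integral_const_on_lmeasurable:
  fixes a :: "'b::euclidean_space"
  assumes "K \<in> lmeasurable"
  shows "((\<lambda>x. a) has_integral measure lebesgue K *\<^sub>R a) K"
proof -
  have "((\<lambda>x. 1) has_integral measure lebesgue K) K"
    using assms by (metis integrable_integral lmeasurable_iff_integrable_on lmeasure_integral)
  from has_integral_linear[OF this bounded_linear_scaleR_left[of a]]
  show ?thesis by (simp add: o_def)
qed

lemma compact_affine_image:
  fixes L :: "'a::euclidean_space \<Rightarrow> 'b::euclidean_space"
  assumes "compact K" "linear L"
  shows "compact ((\<lambda>x. a + L x) ` K)"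
proof (rule compact_continuous_image)
  show "continuous_on K (\<lambda>x. a + L x)"
    using assms(2)
    by (intro continuous_on_add continuous_on_const linear_continuous_on)
       (simp add: linear_conv_bounded_linear)
qed (rule assms)

text \<open>The determinant of the linear part scales both the volume and the integral, and cancels.\<close>

lemma center_of_mass_affine_ordered:
  fixes K :: "(real ^ 'm::{finite,wellorder}) set" and L :: "real ^ 'm::_ \<Rightarrow> real ^ 'm::_"
  assumes K: "compact K" and m: "measure lebesgue K \<noteq> 0" and L: "linear L" "inj L"
  shows "center_of_mass ((\<lambda>x. a + L x) ` K) = a + L (center_of_mass K)"
proof -
  define g where "g = (\<lambda>x. a + L x)"
  define d where "d = \<bar>det (matrix L)\<bar>"
  have bl: "bounded_linear L" using L linear_conv_bounded_linear by blast
  have Kl: "K \<in> lmeasurable" using K by (rule lmeasurable_compact)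
  have meas: "measure lebesgue (g ` K) = d * measure lebesgue K"
    using measure_linear_image[OF L(1) Kl] measure_translation[of a "L ` K"]
    by (simp add: g_def d_def image_image)
  have d: "d \<noteq> 0"
    using det_nz_iff_inj[OF L(1)] L(2) by (simp add: d_def)
  have ints: "(\<lambda>x. x) integrable_on K"
    using set_borel_integral_eq_integral(1)[of K "\<lambda>x. x"] borel_integrable_compact[OF K, of "\<lambda>x. x"]
    by (auto simp: set_integrable_def)
  have intL: "L integrable_on K" and intLeq: "integral K L = L (integral K (\<lambda>x. x))"
    using integrable_linear[OF ints bl] integral_linear[OF ints bl] by (auto simp: o_def)
  have cont: "continuous_on K g"
    unfolding g_def using bl by (intro continuous_intros linear_continuous_on)
  have absK: "g absolutely_integrable_on K"
  proof -
    have "integrable lborel (\<lambda>x. indicator K x *\<^sub>R g x)"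
      by (rule borel_integrable_compact[OF K cont])
    then show ?thesis
      unfolding set_integrable_def by (simp add: integrable_completion)
  qed
  have "integral (g ` K) (\<lambda>x. x) = integral K (\<lambda>x. d *\<^sub>R g x)"
  proof -
    have "(\<lambda>x. x) absolutely_integrable_on g ` K \<and> integral (g ` K) (\<lambda>x. x) = integral K (\<lambda>x. d *\<^sub>R g x)"
    proof (rule has_absolute_integral_change_of_variables[where g' = "\<lambda>_. L", THEN iffD1])
      show "K \<in> sets lebesgue" using Kl by blast
      show "(g has_derivative L) (at x within K)" for x
        unfolding g_def using bl
        by (auto intro!: derivative_eq_intros bounded_linear_imp_has_derivative)
      show "inj_on g K" using L(2) by (auto simp: g_def inj_on_def)
      show "(\<lambda>x. \<bar>det (matrix L)\<bar> *\<^sub>R g x) absolutely_integrable_on K \<and>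
         integral K (\<lambda>x. \<bar>det (matrix L)\<bar> *\<^sub>R g x) = integral K (\<lambda>x. d *\<^sub>R g x)"
        using absK by (auto simp: d_def)
    qed
    then show ?thesis by blast
  qed
  also have "\<dots> = d *\<^sub>R (integral K (\<lambda>x. a) + integral K L)"
    using intL Kl by (simp add: g_def Henstock_Kurzweil_Integration.integral_add integrable_on_const)
  also have "integral K (\<lambda>x. a) = measure lebesgue K *\<^sub>R a"
    using has_integral_const_on_lmeasurable[OF Kl] by (rule integral_unique)
  finally show ?thesis
    unfolding g_def[symmetric]
    using d m by (simp add: center_of_mass_def meas intLeq linear_cmul[OF L(1)] scaleR_add_right)
qed

lemma center_of_mass_affine:
  fixes K :: "(real ^ 'n) set" and L :: "real ^ 'n \<Rightarrow> real ^ 'n"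
  assumes K: "compact K" and m: "measure lebesgue K \<noteq> 0" and L: "linear L" "inj L"
  shows "center_of_mass ((\<lambda>x. a + L x) ` K) = a + L (center_of_mass K)"
proof -
  define L' where "L' = relabel \<circ> L \<circ> unlabel"
  have linL': "linear L'"
    unfolding L'_def by (intro linear_compose linear_relabel linear_unlabel L)
  have injL': "inj L'"
    unfolding L'_def using L(2) 
    by (intro inj_compose) (metis injI relabel_unlabel unlabel_relabel)+
  have K': "compact (relabel ` K)" using K by (rule compact_relabel)
  have AK: "compact ((\<lambda>x. a + L x) ` K)"
    using K L(1) by (rule compact_affine_image)
  have m': "measure lebesgue (relabel ` K) \<noteq> 0"
    using m measure_relabel[OF K] K K' by (simp add: borel_compact)
  have img: "relabel ` (\<lambda>x. a + L x) ` K = (\<lambda>y. relabel a + L' y) ` relabel ` K"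
    by (simp add: image_image L'_def linear_add[OF linear_relabel])
  have "relabel (center_of_mass ((\<lambda>x. a + L x) ` K))
      = center_of_mass ((\<lambda>y. relabel a + L' y) ` relabel ` K)"
    by (simp add: center_of_mass_relabel[OF AK, symmetric] img)
  also have "\<dots> = relabel a + L' (relabel (center_of_mass K))"
    by (simp add: center_of_mass_affine_ordered[OF K' m' linL' injL'] center_of_mass_relabel[OF K])
  also have "\<dots> = relabel (a + L (center_of_mass K))"
    by (simp add: L'_def linear_add[OF linear_relabel])
  finally show ?thesis by (metis unlabel_relabel)
qed

text \<open>If \<open>c\<close> were not interior, some functional \<open>a\<close> would satisfy \<open>a \<bullet> c \<le> a \<bullet> x\<close> on \<open>K\<close>. Both sides have
  the same integral over \<open>K\<close>, so the continuous function \<open>a \<bullet> x - a \<bullet> c\<close> would vanish on the interior,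
  but it grows in the direction \<open>a\<close>.\<close>

lemma center_of_mass_in_interior:
  fixes K :: "'a::euclidean_space set"
  assumes "convex_body K"
  shows "center_of_mass K \<in> interior K" and "measure lebesgue K \<noteq> 0"
proof -
  have K: "convex K" "compact K" "interior K \<noteq> {}"
    using assms by (auto simp: convex_body_def)
  have Kl: "K \<in> lmeasurable" using K by (simp add: lmeasurable_compact)
  have nn: "\<not> negligible (interior K)"
    using K(3) open_not_negligible by blast
  then show m: "measure lebesgue K \<noteq> 0"
    using negligible_iff_measure0[OF Kl] negligible_subset[OF _ interior_subset] by blast
  define c where "c = center_of_mass K"
  show "center_of_mass K \<in> interior K"
  proof (rule ccontr)
    assume "center_of_mass K \<notin> interior K"
    then have "c \<notin> interior K" by (simp add: c_def)
    moreover have "convex (interior K)" using K by (simp add: convex_interior)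
    ultimately obtain a b where a: "a \<noteq> 0" "a \<bullet> c \<le> b" "\<forall>x\<in>interior K. b \<le> a \<bullet> x"
      using separating_hyperplane_sets[of "{c}" "interior K"] K(3) by auto
    have cl: "closure (interior K) = K"
      using K by (simp add: convex_closure_interior compact_imp_closed)
    have le: "a \<bullet> c \<le> a \<bullet> x" if "x \<in> K" for x
    proof -
      have "closure (interior K) \<subseteq> {x. b \<le> a \<bullet> x}"
        using a(3) by (intro closure_minimal) (auto simp: closed_halfspace_ge)
      then show ?thesis using that a(2) cl by auto
    qed
    have ints: "(\<lambda>x. x) integrable_on K"
      using set_borel_integral_eq_integral(1)[of K "\<lambda>x. x"] borel_integrable_compact[OF K(2), of "\<lambda>x. x"]
      by (auto simp: set_integrable_def)
    have eq: "a \<bullet> integral K (\<lambda>x. x) = measure lebesgue K * (a \<bullet> c)"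
      using m by (simp add: c_def center_of_mass_def)
    have hi: "((\<lambda>x. a \<bullet> x) has_integral a \<bullet> integral K (\<lambda>x. x)) K"
      using has_integral_linear[OF integrable_integral[OF ints] bounded_linear_inner_right]
      by (simp add: o_def)
    have hc: "((\<lambda>x. a \<bullet> c) has_integral measure lebesgue K * (a \<bullet> c)) K"
      using has_integral_const_on_lmeasurable[OF Kl, of "a \<bullet> c"] by simp
    have z: "((\<lambda>x. a \<bullet> x - a \<bullet> c) has_integral 0) K"
      using has_integral_diff[OF hi hc] eq by simp
    obtain z0 r where z0: "r > 0" "ball z0 r \<subseteq> K"
      using K(3) by (metis ex_in_conv mem_interior)
    define z where "z = z0 + (r / 2 / norm a) *\<^sub>R a"
    have "a \<bullet> z0 < a \<bullet> z"
      using z0(1) a(1) by (simp add: z_def inner_add_right)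
    then have az: "a \<bullet> c < a \<bullet> z" using le[of z0] z0 by force
    have "z \<in> interior K"
      using z0 a(1) by (intro interiorI[of "ball z0 r"]) (auto simp: z_def dist_norm)
    then obtain l u where lu: "z \<in> box l u" "cbox l u \<subseteq> interior K"
      by (metis open_contains_cbox open_interior)
    then have sub: "cbox l u \<subseteq> K" using interior_subset by blast
    define f where "f = (\<lambda>x. a \<bullet> x - a \<bullet> c)"
    have cont: "continuous_on (cbox l u) f"
      unfolding f_def by (intro continuous_intros)
    have fi: "f integrable_on cbox l u" by (rule integrable_continuous[OF cont])
    have "integral (cbox l u) f \<le> integral K f"
      using sub fi z le by (intro integral_subset_le) (auto simp: f_def integrable_on_def)
    also have "\<dots> = 0" using z by (simp add: f_def integral_unique)
    finally have "integral (cbox l u) f = 0"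
      using integral_nonneg[OF fi] le sub by (force simp: f_def)
    then have "(f has_integral 0) (cbox l u)" using fi by (metis integrable_integral)
    moreover have "0 \<le> f x" if "x \<in> box l u" for x
      using le[of x] sub that box_subset_cbox[of l u] by (auto simp: f_def subset_iff)
    moreover have "box l u \<noteq> {}" "z \<in> cbox l u"
      using lu(1) box_subset_cbox[of l u] by blast+
    ultimately have "f z = 0"
      using has_integral_0_cbox_imp_0[OF cont] by blast
    then show False using az by (simp add: f_def)
  qed
qed

section \<open>Reduction to the stretched distance\<close>

lemma closest_point_hyperplane:
  fixes c :: "'a::euclidean_space"
  assumes u: "norm u = 1" and H: "H = {x. u \<bullet> (x - c) = 0}"
  shows "closest_point H x = x - (u \<bullet> (x - c)) *\<^sub>R u"
proof -
  let ?y = "x - (u \<bullet> (x - c)) *\<^sub>R u"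
  have H': "H = {x. u \<bullet> x = u \<bullet> c}" unfolding H by (simp add: inner_diff_right)
  have uu: "u \<bullet> u = 1" using u by (simp add: norm_eq_1)
  have "?y = closest_point H x"
  proof (rule closest_point_unique)
    show "convex H" "closed H" unfolding H' by (simp_all add: convex_hyperplane closed_hyperplane)
    show "?y \<in> H" unfolding H using uu by (simp add: inner_diff_right algebra_simps)
    show "\<forall>z\<in>H. dist x ?y \<le> dist x z"
    proof
      fix z assume "z \<in> H"
      then have "u \<bullet> (x - c) = u \<bullet> (x - z)" by (simp add: H inner_diff_right)
      then have "dist x ?y = \<bar>u \<bullet> (x - z)\<bar>" using u by (simp add: dist_norm)
      also have "\<dots> \<le> dist x z" using Cauchy_Schwarz_ineq2[of u "x - z"] u by (simp add: dist_norm)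
      finally show "dist x ?y \<le> dist x z" .
    qed
  qed
  then show ?thesis by simp
qed

lemma hyperplane_unit_normal:
  fixes c :: "'a::euclidean_space"
  assumes "hyperplane H" "c \<in> H"
  obtains u where "norm u = 1" "H = {x. u \<bullet> (x - c) = 0}"
proof -
  obtain a b where a: "a \<noteq> 0" "H = {x. a \<bullet> x = b}" using assms(1) by (auto simp: hyperplane_def)
  have "H = {x. sgn a \<bullet> (x - c) = 0}"
    using assms(2) a by (auto simp: sgn_div_norm inner_diff_right)
  then show ?thesis using that[of "sgn a"] a by (simp add: norm_sgn)
qed

lemma frontier_affine_image:
  fixes L :: "'a::euclidean_space \<Rightarrow> 'a"
  assumes L: "linear L" "inj L"
  shows "frontier ((\<lambda>x. a + L x) ` S) = (\<lambda>x. a + L x) ` frontier S"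
proof -
  have "frontier (L ` S) = L ` frontier S"
    using L by (simp add: frontier_def closure_injective_linear_image[symmetric]
        interior_injective_linear_image image_set_diff)
  then have "frontier ((+) a ` (L ` S)) = (+) a ` (L ` frontier S)"
    by (simp add: frontier_translation)
  then show ?thesis by (simp add: image_image)
qed

text \<open>For \<open>t > 1\<close> the affinity expands distances, by a factor of at most \<open>t\<close>, so it carries local maxima
  to local maxima in both directions.\<close>

lemma num_unstable_eq_card_local_max:
  fixes K :: "(real ^ 'n) set"
  assumes K: "convex_body K" and c: "c = center_of_mass K"
    and u: "norm u = 1" and H: "H = {x. u \<bullet> (x - c) = 0}" and t: "t > 1"
  shows "num_unstable K H t = card (local_max_points (height_form c u (1 / (t\<^sup>2 - 1))) (frontier K))"
proof -
  have uu: "u \<bullet> u = 1" using u by (simp add: norm_eq_1)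
  define L where "L x = x + ((t - 1) * (u \<bullet> x)) *\<^sub>R u" for x
  define a where "a = - (((t - 1) * (u \<bullet> c)) *\<^sub>R u)"
  define A where "A = (\<lambda>x. a + L x)"
  have linL: "linear L"
    by (rule linearI) (simp_all add: L_def inner_add_right algebra_simps)
  have normL: "(norm (L h))\<^sup>2 = (norm h)\<^sup>2 + (t\<^sup>2 - 1) * (u \<bullet> h)\<^sup>2" for h
    using norm_scaleR_add_power2[of 1 h "(t - 1) * (u \<bullet> h)" u] u
    by (simp add: L_def power2_eq_square algebra_simps)
  have t2: "t\<^sup>2 - 1 > 0" using t by (simp add: power2_eq_square less_1_mult)
  have lower: "norm h \<le> norm (L h)" for h
  proof (rule power2_le_imp_le)
    show "(norm h)\<^sup>2 \<le> (norm (L h))\<^sup>2" unfolding normL using t2 by simp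
  qed simp
  have upper: "norm (L h) \<le> t * norm h" for h
  proof (rule power2_le_imp_le)
    have "(u \<bullet> h)\<^sup>2 \<le> (norm h)\<^sup>2"
      using Cauchy_Schwarz_ineq2[of u h] u by (metis abs_le_square_iff abs_norm_cancel mult_1)
    then have "(t\<^sup>2 - 1) * (u \<bullet> h)\<^sup>2 \<le> (t\<^sup>2 - 1) * (norm h)\<^sup>2" using t2 by (intro mult_left_mono) auto
    then show "(norm (L h))\<^sup>2 \<le> (t * norm h)\<^sup>2" by (simp add: normL power_mult_distrib algebra_simps)
    show "0 \<le> t * norm h" using t by simp
  qed
  have injL: "inj L"
    unfolding linear_injective_0[OF linL] using lower by (metis norm_le_zero_iff norm_zero)
  have Adiff: "A x - A y = L (x - y)" for x y
    by (simp add: A_def linear_diff[OF linL])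
  have injA: "inj A" using injL by (auto simp: A_def inj_def)
  have Aeq: "orth_affinity H t x = A x" for x
    unfolding orth_affinity_def closest_point_hyperplane[OF u H]
    by (simp add: A_def a_def L_def inner_diff_right algebra_simps)
  have Ac: "A c = c" by (simp add: A_def a_def L_def)
  have com: "center_of_mass (A ` K) = c"
    unfolding A_def using K center_of_mass_in_interior(2)[OF K] Ac c
    by (subst center_of_mass_affine[OF _ _ linL injL]) (auto simp: convex_body_def A_def)
  have fr: "frontier (A ` K) = A ` frontier K"
    unfolding A_def by (rule frontier_affine_image[OF linL injL])
  define g where "g = height_form c u (1 / (t\<^sup>2 - 1))"
  have "(dist c (A x))\<^sup>2 = (t\<^sup>2 - 1) * g x" for x
  proof -
    have "dist c (A x) = norm (L (x - c))" using Adiff[of x c] Ac by (simp add: dist_norm norm_minus_commute[of c])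
    then show ?thesis using t2 by (simp add: normL g_def height_form_def distrib_left del: inner_diff_right)
  qed
  then have cmp: "dist c (A x) \<le> dist c (A y) \<longleftrightarrow> g x \<le> g y" for x y
    using t2 by (metis abs_le_square_iff abs_of_nonneg mult_le_cancel_left_pos zero_le_dist)
  have "unstable_points (A ` K) = A ` local_max_points g (frontier K)"
  proof (intro equalityI subsetI)
    fix p' assume "p' \<in> unstable_points (A ` K)"
    then obtain p e where p: "p' = A p" "p \<in> frontier K" "e > 0"
      and max: "\<forall>q\<in>A ` frontier K \<inter> ball (A p) e. dist c q \<le> dist c (A p)"
      unfolding unstable_points_def com fr by blast
    have near: "g q \<le> g p" if "q \<in> frontier K" "A q \<in> ball (A p) e" for q
      using bspec[OF max, of "A q"] that cmp by simp
    have "g q \<le> g p" if q: "q \<in> frontier K" "q \<in> ball p (e / t)" for q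
    proof (rule near[OF q(1)])
      have "dist (A p) (A q) \<le> t * dist p q" using upper[of "p - q"] by (simp add: dist_norm Adiff)
      also have "\<dots> < e" using q(2) t by (simp add: field_simps)
      finally show "A q \<in> ball (A p) e" by simp
    qed
    then have "p \<in> local_max_points g (frontier K)"
      using p t unfolding local_max_points_def by (auto intro!: exI[of _ "e / t"])
    then show "p' \<in> A ` local_max_points g (frontier K)" using p(1) by blast
  next
    fix p' assume "p' \<in> A ` local_max_points g (frontier K)"
    then obtain p e where p: "p' = A p" "p \<in> frontier K" "e > 0"
      "\<And>q. q \<in> frontier K \<Longrightarrow> q \<in> ball p e \<Longrightarrow> g q \<le> g p"
      unfolding local_max_points_def by auto
    have "g q \<le> g p" if q: "q \<in> frontier K" "A q \<in> ball (A p) e" for q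
    proof (rule p(4)[OF q(1)])
      have "dist p q \<le> dist (A p) (A q)" using lower[of "p - q"] by (simp add: dist_norm Adiff)
      then show "q \<in> ball p e" using q(2) by simp
    qed
    then show "p' \<in> unstable_points (A ` K)"
      unfolding unstable_points_def com fr using p cmp by (auto intro!: exI[of _ e])
  qed
  moreover have "orth_affinity H t ` K = A ` K" using Aeq by simp
  ultimately show ?thesis
    unfolding num_unstable_def g_def using injA by (simp add: card_image inj_on_subset)
qed

theorem theorem8:
  fixes K H :: "(real ^ 'n) set"
  assumes "CARD('n) \<ge> 2"
    and "Ck_convex_body 3 K"
    and "\<forall>x\<in>frontier K. gaussian_curvature K x \<noteq> 0"
    and "hyperplane H"
    and "center_of_mass K \<in> H"
  shows "\<exists>t\<^sub>0>0. \<forall>t\<ge>t\<^sub>0. num_unstable K H t = 2"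
proof -
  define c where "c = center_of_mass K"
  have K: "convex_body K" using assms(2) by (simp add: Ck_convex_body_def)
  obtain u where u: "norm u = 1" "H = {x. u \<bullet> (x - c) = 0}"
    using hyperplane_unit_normal[OF assms(4,5)] unfolding c_def by metis
  have c: "c \<in> interior K" unfolding c_def by (rule center_of_mass_in_interior(1)[OF K])
  obtain e0 where e0: "e0 > 0"
    "\<And>e. 0 < e \<Longrightarrow> e < e0 \<Longrightarrow> card (local_max_points (height_form c u e) (frontier K)) = 2"
    using exactly_two_local_max[OF assms(2,3) c u(1)] by metis
  \<comment> \<open>Then \<open>t\<^sup>2 - 1 \<ge> t - 1 > 1 / e0\<close> for \<open>t \<ge> t0\<close>.\<close>
  define t0 where "t0 = 2 + 1 / e0"
  have t0: "t0 > 1" using e0 by (simp add: t0_def add_pos_pos)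
  have "num_unstable K H t = 2" if t: "t \<ge> t0" for t
  proof -
    have t1: "t > 1" using t t0 by simp
    have "1 / e0 < t - 1" using t by (simp add: t0_def)
    also have "t - 1 \<le> (t - 1) * (t + 1)" using t1 by simp
    also have "\<dots> = t\<^sup>2 - 1" by (simp add: power2_eq_square algebra_simps)
    finally have *: "1 / e0 < t\<^sup>2 - 1" .
    then have pos: "t\<^sup>2 - 1 > 0" using e0(1) by (meson less_trans zero_less_divide_1_iff)
    then have "1 / (t\<^sup>2 - 1) < e0" using * e0(1) by (simp add: field_simps)
    then show ?thesis
      using num_unstable_eq_card_local_max[OF K c_def u t1] e0(2) pos by simp
  qed
  then show ?thesis using t0 by (intro exI[of _ t0]) auto
qed

end
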